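(* Let $(X_1,\dots,X_M)$ have density $f\in\mathrm{MMEam}$ of the form $f(x_1,\dots,x_M)=\sum_{\mathbf i\in\mathscr S}p_{\mathbf i}f_{i_1}(x_1)\cdots f_{i_M}(x_M)$ and $S=\sum_{j=1}^MX_j$. Then for $r\in\mathbb N_+$ and $d\ge0$ (with $\mathbb P(S>d)>0$), $$\mathbb E[(S-d)_+^r]=\Big(\sum_{\mathbf i\in\mathscr S}p^{\mathrm{RL}}_{S,d,\mathbf i}\,r!\,\alpha^{\mathrm{RL}}_{S,d,\mathbf i}(-T_{\mathbf i})^{-(r+1)}t_{\mathbf i}\Big)\Big(\sum_{\mathbf i\in\mathscr S}p_{\mathbf i}\,\alpha_{\mathbf i}e^{T_{\mathbf i}d}l_{\mathbf i}\Big),$$ where $l_{\mathbf i}=(-T_{\mathbf i})^{-1}t_{\mathbf i}$, $$p^{\mathrm{RL}}_{S,d,\mathbf i}=\frac{p_{\mathbf i}(\alpha_{\mathbf i}e^{T_{\mathbf i}d}l_{\mathbf i})}{\sum_{\mathbf h\in\mathscr S}p_{\mathbf h}(\alpha_{\mathbf h}e^{T_{\mathbf h}d}l_{\mathbf h})},\qquad \alpha^{\mathrm{RL}}_{S,d,\mathbf i}=\frac{1}{\alpha_{\mathbf i}e^{T_{\mathbf i}d}l_{\mathbf i}}\alpha_{\mathbf i}e^{T_{\mathbf i}d},$$ and $\alpha_{\mathbf i}=(\alpha_{i_1},0,\dots,0)$, $t_{\mathbf i}=(0,\dots,0,t_{i_M}^\top)^\top$, and $T_{\mathbf i}$ is the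 $M\times M$ block upper bidiagonal matrix with diagonal blocks $T_{i_1},\dots,T_{i_M}$, blocks $t_{i_k}\alpha_{i_{k+1}}$ in position $(k,k+1)$ for $1\le k\le M-1$, and zero blocks elsewhere.
   Context: An ME density is a probability density on $[0,\infty)$ of the form $g(x)=\alpha e^{Tx}t$ ($\alpha$ real row vector, $T$ real square matrix, $t$ real column vector); triples are taken with all eigenvalues of $T$ having strictly negative real part, so $T$ is invertible. MMEam: fix $L,M\in\mathbb N_+$ and ME densities $f_1,\dots,f_L$ with triples $(\alpha_j,T_j,t_j)$. Let $\mathscr S=\{1,\dots,L\}^M$, $\mathbf i=(i_1,\dots,i_M)$, and real numbers $p_{\mathbf i}$ (possibly negative) with $\sum p_{\mathbf i}=1$; $f(x)=\sum_{\mathbf i}p_{\mathbf i}f_{i_1}(x_1)\cdots f_{i_M}(x_M)$ on $[0,\infty)^M$ is an MMEam density if $f\ge0$. $(y)_+=\max(y,0)$. *)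

theory Defs
  imports "HOL-Probability.Probability" "Jordan_Normal_Form.Char_Poly"
begin

definition mexp :: "real mat \<Rightarrow> real mat" where
  "mexp A = mat (dim_row A) (dim_col A)
     (\<lambda>(i,j). \<Sum>n. (A ^\<^sub>m n) $$ (i,j) / fact n)"

definition minv :: "real mat \<Rightarrow> real mat" where
  "minv A = (THE B. B \<in> carrier_mat (dim_row A) (dim_row A) \<and>
                    A * B = 1\<^sub>m (dim_row A) \<and> B * A = 1\<^sub>m (dim_row A))"

definition ME_triple :: "real vec \<Rightarrow> real mat \<Rightarrow> real vec \<Rightarrow> bool" where
  "ME_triple \<alpha> T t \<longleftrightarrow> T \<in> carrier_mat (dim_vec \<alpha>) (dim_vec \<alpha>) \<and> dim_vec t = dim_vec \<alpha> \<and>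
     (\<forall>k. eigenvalue (map_mat complex_of_real T) k \<longrightarrow> Re k < 0)"

definition ME_fun :: "real vec \<Rightarrow> real mat \<Rightarrow> real vec \<Rightarrow> real \<Rightarrow> real" where
  "ME_fun \<alpha> T t x = \<alpha> \<bullet> (mexp (x \<cdot>\<^sub>m T) *\<^sub>v t)"

definition ME_density :: "real vec \<Rightarrow> real mat \<Rightarrow> real vec \<Rightarrow> bool" where
  "ME_density \<alpha> T t \<longleftrightarrow> ME_triple \<alpha> T t \<and> (\<forall>x\<ge>0. ME_fun \<alpha> T t x \<ge> 0) \<and>
     ((\<lambda>x. ME_fun \<alpha> T t x) has_integral 1) {0..}"

text \<open>For a list of triples [(a1,T1,t1),...,(aM,TM,tM)] this gives
  alpha = (a1,0,...,0), t = (0,...,0,tM) and the block upper bidiagonal matrix with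
  diagonal blocks T_k and blocks t_k a_{k+1} in position (k,k+1).  Recursively:
  T = [[T1, t1 alpha_rest],[0, T_rest]] where alpha_rest = (a2,0,...,0).\<close>
fun blk :: "(real vec \<times> real mat \<times> real vec) list \<Rightarrow> real vec \<times> real mat \<times> real vec" where
  "blk [] = (vec 0 (\<lambda>_. 0), 0\<^sub>m 0 0, vec 0 (\<lambda>_. 0))"
| "blk [c] = c"
| "blk (c # d # cs) =
     (let (a', T', t') = blk (d # cs); (a, T, t) = c in
       (a @\<^sub>v 0\<^sub>v (dim_vec a'),
        four_block_mat T (mat (dim_vec a) (dim_vec a') (\<lambda>(i,j). t $ i * a' $ j))
                       (0\<^sub>m (dim_vec a') (dim_vec a)) T',
        0\<^sub>v (dim_vec a) @\<^sub>v t'))"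

definition idx_set :: "nat \<Rightarrow> nat \<Rightarrow> nat list set" where
  "idx_set L M = {is. length is = M \<and> set is \<subseteq> {1..L}}"

definition alpha_I :: "(nat \<Rightarrow> real vec) \<Rightarrow> (nat \<Rightarrow> real mat) \<Rightarrow> (nat \<Rightarrow> real vec) \<Rightarrow> nat list \<Rightarrow> real vec" where
  "alpha_I \<alpha> T t is = fst (blk (map (\<lambda>j. (\<alpha> j, T j, t j)) is))"

definition T_I :: "(nat \<Rightarrow> real vec) \<Rightarrow> (nat \<Rightarrow> real mat) \<Rightarrow> (nat \<Rightarrow> real vec) \<Rightarrow> nat list \<Rightarrow> real mat" where
  "T_I \<alpha> T t is = fst (snd (blk (map (\<lambda>j. (\<alpha> j, T j, t j)) is)))"

definition t_I :: "(nat \<Rightarrow> real vec) \<Rightarrow> (nat \<Rightarrow> real mat) \<Rightarrow> (nat \<Rightarrow> real vec) \<Rightarrow> nat list \<Rightarrow> real vec" where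
  "t_I \<alpha> T t is = snd (snd (blk (map (\<lambda>j. (\<alpha> j, T j, t j)) is)))"

definition l_I :: "(nat \<Rightarrow> real vec) \<Rightarrow> (nat \<Rightarrow> real mat) \<Rightarrow> (nat \<Rightarrow> real vec) \<Rightarrow> nat list \<Rightarrow> real vec" where
  "l_I \<alpha> T t is = minv (- T_I \<alpha> T t is) *\<^sub>v t_I \<alpha> T t is"

definition surv_I :: "(nat \<Rightarrow> real vec) \<Rightarrow> (nat \<Rightarrow> real mat) \<Rightarrow> (nat \<Rightarrow> real vec) \<Rightarrow> nat list \<Rightarrow> real \<Rightarrow> real" where
  "surv_I \<alpha> T t is d = alpha_I \<alpha> T t is \<bullet> (mexp (d \<cdot>\<^sub>m T_I \<alpha> T t is) *\<^sub>v l_I \<alpha> T t is)"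

definition pRL :: "nat \<Rightarrow> nat \<Rightarrow> (nat list \<Rightarrow> real) \<Rightarrow> (nat \<Rightarrow> real vec) \<Rightarrow> (nat \<Rightarrow> real mat) \<Rightarrow> (nat \<Rightarrow> real vec) \<Rightarrow> real \<Rightarrow> nat list \<Rightarrow> real" where
  "pRL L M p \<alpha> T t d is = p is * surv_I \<alpha> T t is d /
      (\<Sum>hs\<in>idx_set L M. p hs * surv_I \<alpha> T t hs d)"

text \<open>alpha^RL_{S,d,i} (a row vector: alpha_i e^{T_i d}, scaled)\<close>
definition alphaRL :: "(nat \<Rightarrow> real vec) \<Rightarrow> (nat \<Rightarrow> real mat) \<Rightarrow> (nat \<Rightarrow> real vec) \<Rightarrow> real \<Rightarrow> nat list \<Rightarrow> real vec" where
  "alphaRL \<alpha> T t d is = (1 / surv_I \<alpha> T t is d) \<cdot>\<^sub>v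
      (transpose_mat (mexp (d \<cdot>\<^sub>m T_I \<alpha> T t is)) *\<^sub>v alpha_I \<alpha> T t is)"

text \<open>The MMEam density function on [0,inf)^M (extended by 0 outside); the
  coordinates x_1..x_M are x 0 .. x (M-1).\<close>
definition MMEam_fun :: "nat \<Rightarrow> nat \<Rightarrow> (nat list \<Rightarrow> real) \<Rightarrow> (nat \<Rightarrow> real vec) \<Rightarrow> (nat \<Rightarrow> real mat) \<Rightarrow> (nat \<Rightarrow> real vec) \<Rightarrow> (nat \<Rightarrow> real) \<Rightarrow> real" where
  "MMEam_fun L M p \<alpha> T t x = (if \<forall>k<M. 0 \<le> x k then
      (\<Sum>is\<in>idx_set L M. p is * (\<Prod>k<M. ME_fun (\<alpha> (is ! k)) (T (is ! k)) (t (is ! k)) (x k)))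
     else 0)"

end

theory Submission
  imports Defs "Jordan_Normal_Form.Schur_Decomposition"
begin

text \<open>Schur triangularisation shows that \<open>e\<^bsup>xT\<^esup>\<close> decays exponentially, so
  repeated integration by parts gives
  \<open>\<integral>\<^sub>d\<^sup>\<infinity> (x - d)\<^sup>r \<alpha> e\<^bsup>xT\<^esup> t dx = r! \<alpha> e\<^bsup>dT\<^esup> (-T)\<^bsup>-(r+1)\<^esup> t\<close>. The block matrix \<open>T\<^sub>i\<close> encodes
  convolution (variation of constants for the block triangular system), so the law of \<open>S\<close> has density
  \<open>\<Sum>\<^sub>i p\<^sub>i \<alpha>\<^sub>i e\<^bsup>sT\<^sub>i\<^esup> t\<^sub>i\<close> and \<open>P(S > d)\<close> is the common denominator of the residual-life weights.
  If a component has survival probability 0 at \<open>d\<close>, its residual-life vector involves a division by zero,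
  but its contribution to the moment vanishes as well, because its density is nonnegative.\<close>

text \<open>The weights p_i may be negative, while the integral identities are cheapest for
  nonnegative integrands. Signs are therefore kept out as long as possible: each product f_{i_1} ...
  f_{i_M} is nonnegative, so its contribution is computed as a finite extended nonnegative integral,
  turned into a Bochner integral, and only then weighted by p_i in a finite sum. This forces
  nonnegativity of every block density and every tail moment to be proved along the way, since
  \<open>ennreal\<close> sends negative reals to 0. The one-dimensional integrals are all evaluated
  through explicit antiderivatives. Exponentials enter through their action e^{zA} v on vectors,
  whose components are scalar power series, so that no calculus of matrix-valued functions is
  required. The field is generic because Schur triangularisation lives over the complex numbers
  while the statement is real.\<close>

no_notation inner (infix "\<bullet>" 70)
no_notation vec_nth (infixl "$" 90)

section \<open>The action of a matrix exponential on a vector\<close>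

definition expv :: "'a :: {real_normed_field, banach} mat \<Rightarrow> 'a vec \<Rightarrow> 'a \<Rightarrow> 'a vec" where
  "expv A v z = vec (dim_row A) (\<lambda>i. \<Sum>n. (A ^\<^sub>m n *\<^sub>v v) $ i / fact n * z ^ n)"

lemma dim_expv [simp]: "dim_vec (expv A v z) = dim_row A"
  by (simp add: expv_def)

lemma expv_carrier [simp, intro]: "A \<in> carrier_mat n n \<Longrightarrow> expv A v z \<in> carrier_vec n"
  by (intro carrier_vecI) simp

lemma scalar_prod_sum:
  assumes "u \<in> carrier_vec n" "v \<in> carrier_vec n"
  shows "u \<bullet> v = (\<Sum>i<n. u $ i * v $ i)"
  using assms by (simp add: scalar_prod_def atLeast0LessThan)

lemma index_mat_mult_vec_sum:
  assumes "A \<in> carrier_mat n m" "v \<in> carrier_vec m" "i < n"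
  shows "(A *\<^sub>v v) $ i = (\<Sum>k<m. A $$ (i, k) * v $ k)"
  using assms scalar_prod_sum[of "row A i" m v] by simp

lemma pow_mat_mult_vec_carrier [simp, intro]:
  "A \<in> carrier_mat n n \<Longrightarrow> v \<in> carrier_vec n \<Longrightarrow> A ^\<^sub>m k *\<^sub>v v \<in> carrier_vec n"
  by (rule mult_mat_vec_carrier[OF pow_carrier_mat])

lemma pow_mat_Suc_mult_vec:
  fixes A :: "'a :: semiring_1 mat"
  assumes A: "A \<in> carrier_mat n n" and v: "v \<in> carrier_vec n"
  shows "A ^\<^sub>m Suc k *\<^sub>v v = A ^\<^sub>m k *\<^sub>v (A *\<^sub>v v)"
  using assms by (simp add: assoc_mult_mat_vec[of _ n n _ n])

lemma pow_mat_Suc_mult_vec':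
  fixes A :: "'a :: semiring_1 mat"
  assumes A: "A \<in> carrier_mat n n" and v: "v \<in> carrier_vec n"
  shows "A ^\<^sub>m Suc k *\<^sub>v v = A *\<^sub>v (A ^\<^sub>m k *\<^sub>v v)"
  using v
proof (induction k arbitrary: v)
  case 0
  then show ?case using A by simp
next
  case (Suc k)
  have "A ^\<^sub>m Suc (Suc k) *\<^sub>v v = A ^\<^sub>m Suc k *\<^sub>v (A *\<^sub>v v)"
    using pow_mat_Suc_mult_vec[OF A Suc.prems, of "Suc k"] .
  also have "\<dots> = A *\<^sub>v (A ^\<^sub>m k *\<^sub>v (A *\<^sub>v v))"
    using Suc.IH[of "A *\<^sub>v v"] Suc.prems A by simp
  also have "\<dots> = A *\<^sub>v (A ^\<^sub>m Suc k *\<^sub>v v)"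
    using pow_mat_Suc_mult_vec[OF A Suc.prems, of k] by simp
  finally show ?case .
qed

text \<open>The sum \<open>c\<close> of the norms of all entries bounds every row sum, so each
  application of A costs at most a factor \<open>c\<close>. This is crude, but any geometric bound
  is beaten by the factorials.\<close>

lemma norm_pow_mat_mult_vec_le:
  fixes A :: "'a :: real_normed_field mat"
  assumes A: "A \<in> carrier_mat n n" and v: "v \<in> carrier_vec n"
  obtains C K where "\<And>k i. i < n \<Longrightarrow> norm ((A ^\<^sub>m k *\<^sub>v v) $ i) \<le> C * K ^ k"
proof -
  define c where "c = (\<Sum>i<n. \<Sum>j<n. norm (A $$ (i, j)))"
  define C where "C = (\<Sum>i<n. norm (v $ i))"
  have C0: "C \<ge> 0" by (auto simp: C_def intro!: sum_nonneg)
  have c0: "c \<ge> 0" by (auto simp: c_def intro!: sum_nonneg)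
  have row: "(\<Sum>j<n. norm (A $$ (i, j))) \<le> c" if "i < n" for i
    unfolding c_def using that
    by (intro member_le_sum[of i "{..<n}" "\<lambda>i. \<Sum>j<n. norm (A $$ (i, j))"]) (auto intro!: sum_nonneg)
  have "norm ((A ^\<^sub>m k *\<^sub>v v) $ i) \<le> C * c ^ k" if "i < n" for k i
    using that
  proof (induction k arbitrary: i)
    case 0
    have "norm (v $ i) \<le> C"
      unfolding C_def using 0 by (intro member_le_sum) auto
    then show ?case using A v by simp
  next
    case (Suc k)
    have "norm ((A ^\<^sub>m Suc k *\<^sub>v v) $ i) = norm (\<Sum>j<n. A $$ (i, j) * (A ^\<^sub>m k *\<^sub>v v) $ j)"
      unfolding pow_mat_Suc_mult_vec'[OF A v]
      by (subst index_mat_mult_vec_sum[OF A _ Suc.prems]) (use A v in auto)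
    also have "\<dots> \<le> (\<Sum>j<n. norm (A $$ (i, j)) * (C * c ^ k))"
      by (rule order_trans[OF norm_sum], rule sum_mono)
         (auto simp: norm_mult intro!: mult_left_mono Suc.IH)
    also have "\<dots> = (\<Sum>j<n. norm (A $$ (i, j))) * (C * c ^ k)"
      by (simp add: sum_distrib_right)
    also have "\<dots> \<le> c * (C * c ^ k)"
      using row[OF Suc.prems] C0 c0 by (intro mult_right_mono) auto
    finally show ?case by (simp add: mult_ac)
  qed
  then show ?thesis using that by blast
qed

lemma summable_expv:
  fixes A :: "'a :: {real_normed_field, banach} mat"
  assumes A: "A \<in> carrier_mat n n" and v: "v \<in> carrier_vec n" and i: "i < n"
  shows "summable (\<lambda>k. (A ^\<^sub>m k *\<^sub>v v) $ i / fact k * z ^ k)"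
proof -
  obtain C K where CK: "\<And>k i. i < n \<Longrightarrow> norm ((A ^\<^sub>m k *\<^sub>v v) $ i) \<le> C * K ^ k"
    using norm_pow_mat_mult_vec_le[OF A v] by blast
  have "summable (\<lambda>k. C * (inverse (fact k) * (K * norm z) ^ k))"
    by (intro summable_mult summable_exp)
  then show ?thesis
  proof (rule summable_comparison_test')
    fix k :: nat
    assume "0 \<le> k"
    have "norm ((A ^\<^sub>m k *\<^sub>v v) $ i / fact k * z ^ k)
        = norm ((A ^\<^sub>m k *\<^sub>v v) $ i) * (inverse (fact k) * norm z ^ k)"
      by (simp add: norm_mult norm_divide norm_inverse norm_power divide_inverse)
    also have "\<dots> \<le> C * K ^ k * (inverse (fact k) * norm z ^ k)"
      by (intro mult_right_mono CK i) auto
    finally show "norm ((A ^\<^sub>m k *\<^sub>v v) $ i / fact k * z ^ k) \<le> C * (inverse (fact k) * (K * norm z) ^ k)"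
      by (simp add: power_mult_distrib mult_ac)
  qed
qed

lemma scalar_prod_expv:
  fixes A :: "'a :: {real_normed_field, banach} mat"
  assumes A: "A \<in> carrier_mat n n" and v: "v \<in> carrier_vec n" and u: "u \<in> carrier_vec n"
  shows "u \<bullet> expv A v z = (\<Sum>k. (u \<bullet> (A ^\<^sub>m k *\<^sub>v v)) / fact k * z ^ k)"
proof -
  have "(\<Sum>k. (u \<bullet> (A ^\<^sub>m k *\<^sub>v v)) / fact k * z ^ k)
      = (\<Sum>k. \<Sum>i<n. u $ i * ((A ^\<^sub>m k *\<^sub>v v) $ i / fact k * z ^ k))"
    using A v u
    by (simp del: index_mult_mat_vec
        add: scalar_prod_sum[of u n] sum_distrib_left sum_distrib_right sum_divide_distrib mult_ac)
  also have "\<dots> = (\<Sum>i<n. \<Sum>k. u $ i * ((A ^\<^sub>m k *\<^sub>v v) $ i / fact k * z ^ k))"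
    by (intro suminf_sum summable_mult summable_expv[OF A v]) auto
  also have "\<dots> = (\<Sum>i<n. u $ i * (\<Sum>k. (A ^\<^sub>m k *\<^sub>v v) $ i / fact k * z ^ k))"
    by (intro sum.cong suminf_mult summable_expv[OF A v]) auto
  also have "\<dots> = u \<bullet> expv A v z"
    using A u by (simp add: scalar_prod_sum[of u n] expv_def)
  finally show ?thesis ..
qed

lemma expv_0:
  fixes A :: "'a :: {real_normed_field, banach} mat"
  assumes A: "A \<in> carrier_mat n n" and v: "v \<in> carrier_vec n"
  shows "expv A v 0 = v"
proof (rule eq_vecI)
  fix i assume i: "i < dim_vec v"
  have "(\<Sum>k. (A ^\<^sub>m k *\<^sub>v v) $ i / fact k * 0 ^ k) = v $ i"
    using suminf_finite[of "{0}" "\<lambda>k. (A ^\<^sub>m k *\<^sub>v v) $ i / fact k * 0 ^ k"] A v by simp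
  then show "expv A v 0 $ i = v $ i" using i A v by (simp add: expv_def)
qed (use A v in auto)

text \<open>It suffices to intertwine the powers. With \<open>P\<close> and \<open>B\<close> equal
  to \<open>A\<close> this makes A commute with its exponential; with a Schur basis change it
  carries the exponential of the triangular factor to that of the original matrix.\<close>

lemma mult_mat_vec_expv:
  fixes A B :: "'a :: {real_normed_field, banach} mat"
  assumes A: "A \<in> carrier_mat n n" and v: "v \<in> carrier_vec n" and w: "w \<in> carrier_vec m"
    and P: "P \<in> carrier_mat m n" and B: "B \<in> carrier_mat m m"
    and comm: "\<And>k. P *\<^sub>v (A ^\<^sub>m k *\<^sub>v v) = B ^\<^sub>m k *\<^sub>v w"
  shows "P *\<^sub>v expv A v z = expv B w z"
proof (rule eq_vecI)
  fix i assume i: "i < dim_vec (expv B w z)"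
  with B P have i': "i < m" "i < dim_row P" by auto
  have "(P *\<^sub>v expv A v z) $ i = row P i \<bullet> expv A v z"
    using i' by simp
  also have "\<dots> = (\<Sum>k. (row P i \<bullet> (A ^\<^sub>m k *\<^sub>v v)) / fact k * z ^ k)"
    by (rule scalar_prod_expv[OF A v]) (use P in auto)
  also have "\<dots> = (\<Sum>k. (B ^\<^sub>m k *\<^sub>v w) $ i / fact k * z ^ k)"
    using i' by (simp del: index_mult_mat_vec add: comm[symmetric] index_mult_mat_vec[OF i'(2), symmetric])
  also have "\<dots> = expv B w z $ i" using B i' by (simp add: expv_def)
  finally show "(P *\<^sub>v expv A v z) $ i = expv B w z $ i" .
qed (use P B in auto)

lemma expv_mult_mat_vec:
  fixes A :: "'a :: {real_normed_field, banach} mat"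
  assumes A: "A \<in> carrier_mat n n" and v: "v \<in> carrier_vec n"
  shows "A *\<^sub>v expv A v z = expv A (A *\<^sub>v v) z"
  by (rule mult_mat_vec_expv[OF A v _ A A])
     (use A v pow_mat_Suc_mult_vec[OF A v] pow_mat_Suc_mult_vec'[OF A v] in auto)

text \<open>Termwise differentiation turns v into A v, and A then moves outside the exponential. The
  expanded row sum is the form in which single rows of y' = A y are used later.\<close>

lemma DERIV_expv:
  fixes A :: "'a :: {real_normed_field, banach} mat"
  assumes A: "A \<in> carrier_mat n n" and v: "v \<in> carrier_vec n" and i: "i < n"
  shows "((\<lambda>z. expv A v z $ i) has_field_derivative (\<Sum>k<n. A $$ (i, k) * expv A v z $ k)) (at z)"
proof -
  have "((\<lambda>z. \<Sum>k. (A ^\<^sub>m k *\<^sub>v v) $ i / fact k * z ^ k) has_field_derivative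
         (\<Sum>k. diffs (\<lambda>k. (A ^\<^sub>m k *\<^sub>v v) $ i / fact k) k * z ^ k)) (at z)"
    by (rule termdiffs_strong_converges_everywhere) (rule summable_expv[OF A v i])
  moreover have "diffs (\<lambda>k. (A ^\<^sub>m k *\<^sub>v v) $ i / fact k) k = (A ^\<^sub>m k *\<^sub>v (A *\<^sub>v v)) $ i / fact k" for k
    unfolding diffs_def pow_mat_Suc_mult_vec[OF A v] by (simp del: of_nat_Suc add: field_simps)
  ultimately have "((\<lambda>z. expv A v z $ i) has_field_derivative expv A (A *\<^sub>v v) z $ i) (at z)"
    using A i by (simp add: expv_def)
  also have "expv A (A *\<^sub>v v) z $ i = (\<Sum>k<n. A $$ (i, k) * expv A v z $ k)"
    using index_mat_mult_vec_sum[OF A expv_carrier[OF A] i, of v z] expv_mult_mat_vec[OF A v]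
    by simp
  finally show ?thesis .
qed

lemma DERIV_scalar_prod_expv:
  fixes A :: "'a :: {real_normed_field, banach} mat"
  assumes A: "A \<in> carrier_mat n n" and v: "v \<in> carrier_vec n" and u: "u \<in> carrier_vec n"
  shows "((\<lambda>z. u \<bullet> expv A v z) has_field_derivative u \<bullet> expv A (A *\<^sub>v v) z) (at z)"
proof -
  have "((\<lambda>z. \<Sum>i<n. u $ i * expv A v z $ i) has_field_derivative
         (\<Sum>i<n. u $ i * (\<Sum>k<n. A $$ (i, k) * expv A v z $ k))) (at z)"
    by (intro DERIV_sum DERIV_cmult DERIV_expv[OF A v]) auto
  also have "(\<Sum>i<n. u $ i * (\<Sum>k<n. A $$ (i, k) * expv A v z $ k)) = u \<bullet> expv A (A *\<^sub>v v) z"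
    unfolding expv_mult_mat_vec[OF A v, symmetric]
    using A by (subst scalar_prod_sum[OF u]) (auto simp del: index_mult_mat_vec simp: index_mat_mult_vec_sum[OF A])
  finally show ?thesis
    using A u by (simp add: scalar_prod_sum[OF u expv_carrier[OF A]])
qed

section \<open>Adjoint exponentials, variation of constants and the semigroup law\<close>

lemma adjoint_pow_mat:
  fixes A :: "'a :: comm_semiring_1 mat"
  assumes A: "A \<in> carrier_mat n n" and v: "v \<in> carrier_vec n" and u: "u \<in> carrier_vec n"
  shows "v \<bullet> (transpose_mat A ^\<^sub>m k *\<^sub>v u) = u \<bullet> (A ^\<^sub>m k *\<^sub>v v)"
  using v
proof (induction k arbitrary: v)
  case 0
  then show ?case using A u by (simp add: comm_scalar_prod[of _ n])
next
  case (Suc k)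
  have At: "transpose_mat A \<in> carrier_mat n n" using A by simp
  have "v \<bullet> (transpose_mat A ^\<^sub>m Suc k *\<^sub>v u) = v \<bullet> (transpose_mat A *\<^sub>v (transpose_mat A ^\<^sub>m k *\<^sub>v u))"
    using pow_mat_Suc_mult_vec'[OF At u] by simp
  also have "\<dots> = (A *\<^sub>v v) \<bullet> (transpose_mat A ^\<^sub>m k *\<^sub>v u)"
    using transpose_vec_mult_scalar[OF At, of "transpose_mat A ^\<^sub>m k *\<^sub>v u" v] Suc.prems At u
    by (simp del: transpose_carrier_mat)
  also have "\<dots> = u \<bullet> (A ^\<^sub>m k *\<^sub>v (A *\<^sub>v v))"
    using Suc.IH[of "A *\<^sub>v v"] A Suc.prems by simp
  finally show ?case using pow_mat_Suc_mult_vec[OF A Suc.prems] by simp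
qed

lemma adjoint_expv:
  fixes A :: "'a :: {real_normed_field, banach} mat"
  assumes A: "A \<in> carrier_mat n n" and v: "v \<in> carrier_vec n" and u: "u \<in> carrier_vec n"
  shows "expv (transpose_mat A) u z \<bullet> v = u \<bullet> expv A v z"
proof -
  have At: "transpose_mat A \<in> carrier_mat n n" using A by simp
  have "expv (transpose_mat A) u z \<bullet> v = v \<bullet> expv (transpose_mat A) u z"
    using At v by (intro comm_scalar_prod[of _ n]) auto
  also have "\<dots> = u \<bullet> expv A v z"
    unfolding scalar_prod_expv[OF At u v] scalar_prod_expv[OF A v u] adjoint_pow_mat[OF A v u] ..
  finally show ?thesis .
qed

text \<open>The row vector \<open>u e\<^bsup>(x-s)A\<^esup>\<close> is expressed as the exponential of the transposed matrix
  acting on \<open>u\<close>, so that only derivatives of vector-valued exponentials occur.\<close>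
lemma DERIV_variation_of_constants:
  fixes A :: "real mat" and y :: "nat \<Rightarrow> real \<Rightarrow> real"
  assumes A: "A \<in> carrier_mat n n" and b: "b \<in> carrier_vec n" and u: "u \<in> carrier_vec n"
    and y: "\<And>i. i < n \<Longrightarrow>
      ((\<lambda>s. y i s) has_field_derivative (\<Sum>k<n. A $$ (i, k) * y k s) + b $ i * g s) (at s)"
  shows "((\<lambda>s. expv (transpose_mat A) u (x - s) \<bullet> vec n (\<lambda>i. y i s)) has_field_derivative
           (u \<bullet> expv A b (x - s)) * g s) (at s)"
proof -
  define q where "q i s = expv (transpose_mat A) u (x - s) $ i" for i s
  have At: "transpose_mat A \<in> carrier_mat n n" using A by simp
  have q: "((\<lambda>s. q i s) has_field_derivative - (\<Sum>k<n. A $$ (k, i) * q k s)) (at s)" if "i < n" for i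
  proof -
    have "((\<lambda>s. expv (transpose_mat A) u (x - s) $ i) has_field_derivative
        (\<Sum>k<n. transpose_mat A $$ (i, k) * expv (transpose_mat A) u (x - s) $ k) * (-1)) (at s)"
      by (rule DERIV_chain2[OF DERIV_expv[OF At u that]]) (auto intro!: derivative_eq_intros)
    then show ?thesis using A that by (simp add: q_def)
  qed
  have "((\<lambda>s. \<Sum>i<n. q i s * y i s) has_field_derivative
      (\<Sum>i<n. - (\<Sum>k<n. A $$ (k, i) * q k s) * y i s
        + ((\<Sum>k<n. A $$ (i, k) * y k s) + b $ i * g s) * q i s)) (at s)"
    by (intro DERIV_sum DERIV_mult q y) auto
  also have "(\<Sum>i<n. - (\<Sum>k<n. A $$ (k, i) * q k s) * y i s
        + ((\<Sum>k<n. A $$ (i, k) * y k s) + b $ i * g s) * q i s)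
      = (\<Sum>i<n. \<Sum>k<n. A $$ (i, k) * y k s * q i s) - (\<Sum>i<n. \<Sum>k<n. A $$ (k, i) * q k s * y i s)
        + (\<Sum>i<n. q i s * b $ i) * g s"
    by (simp add: sum.distrib sum_negf sum_subtractf sum_distrib_right sum_distrib_left algebra_simps)
  \<comment> \<open>The two double sums are transposes of each other: the evolution of the row
    vector cancels the homogeneous part of the equation for \<open>y\<close>, leaving the forcing
    term.\<close>
  also have "(\<Sum>i<n. \<Sum>k<n. A $$ (i, k) * y k s * q i s) = (\<Sum>i<n. \<Sum>k<n. A $$ (k, i) * q k s * y i s)"
    by (subst sum.swap) (simp add: mult_ac)
  also have "(\<Sum>i<n. q i s * b $ i) = u \<bullet> expv A b (x - s)"
    unfolding adjoint_expv[OF A b u, symmetric] using At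
    by (subst scalar_prod_sum[OF _ b]) (auto simp: q_def)
  finally show ?thesis
    using At by (subst scalar_prod_sum[of _ n]) (auto simp: q_def)
qed

text \<open>The semigroup law without multiplying series: u e^{(d-s)A} e^{(x+s)A} v has zero
  derivative in s, by variation of constants with zero forcing, so its values at s = 0 and s = d
  agree.\<close>

lemma scalar_prod_expv_expv:
  fixes A :: "real mat"
  assumes A: "A \<in> carrier_mat n n" and v: "v \<in> carrier_vec n" and u: "u \<in> carrier_vec n"
  shows "u \<bullet> expv A (expv A v x) d = u \<bullet> expv A v (d + x)"
proof -
  define \<phi> where "\<phi> s = expv (transpose_mat A) u (d - s) \<bullet> vec n (\<lambda>i. expv A v (x + s) $ i)" for s
  have At: "transpose_mat A \<in> carrier_mat n n" using A by simp
  have vec_eq: "vec n (\<lambda>i. expv A v z $ i) = expv A v z" for z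
    using A by (intro eq_vecI) auto
  have "(\<phi> has_field_derivative (u \<bullet> expv A (0\<^sub>v n) (d - s)) * 0) (at s)" for s
    unfolding \<phi>_def
  proof (rule DERIV_variation_of_constants[OF A _ u])
    fix i assume i: "i < n"
    have "((\<lambda>s. expv A v (x + s) $ i) has_field_derivative
        (\<Sum>k<n. A $$ (i, k) * expv A v (x + s) $ k) * 1) (at s)"
      by (rule DERIV_chain2[OF DERIV_expv[OF A v i]]) (auto intro!: derivative_eq_intros)
    then show "((\<lambda>s. expv A v (x + s) $ i) has_field_derivative
        (\<Sum>k<n. A $$ (i, k) * expv A v (x + s) $ k) + 0\<^sub>v n $ i * 0) (at s)" by simp
  qed simp
  then have "\<phi> 0 = \<phi> d"
    by (intro DERIV_isconst_all) simp
  then have "expv (transpose_mat A) u d \<bullet> expv A v x = u \<bullet> expv A v (x + d)"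
    using A v u expv_0[OF At u] by (simp add: \<phi>_def vec_eq)
  then show ?thesis
    using adjoint_expv[OF A expv_carrier[OF A] u] by (simp add: add.commute)
qed

section \<open>Identification with the matrix exponential \<open>mexp\<close>\<close>

lemma pow_mat_smult:
  fixes A :: "'a :: comm_semiring_1 mat"
  assumes A: "A \<in> carrier_mat n n"
  shows "(c \<cdot>\<^sub>m A) ^\<^sub>m k = c ^ k \<cdot>\<^sub>m A ^\<^sub>m k"
proof (induction k)
  case 0
  then show ?case using A by (intro eq_matI) auto
next
  case (Suc k)
  have "(c \<cdot>\<^sub>m A) ^\<^sub>m Suc k = (c ^ k \<cdot>\<^sub>m A ^\<^sub>m k) * (c \<cdot>\<^sub>m A)"
    using Suc by simp
  also have "\<dots> = c ^ k \<cdot>\<^sub>m (c \<cdot>\<^sub>m (A ^\<^sub>m k * A))"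
    using A by (subst mult_smult_assoc_mat[of _ n n _ n]) (auto simp: mult_smult_distrib[of _ n n _ n])
  finally show ?case using A by (intro eq_matI) (auto simp: mult_ac)
qed

lemma mexp_carrier [simp, intro]: "A \<in> carrier_mat n n \<Longrightarrow> mexp A \<in> carrier_mat n n"
  by (auto simp: mexp_def)

lemma mexp_smult_mult_vec:
  assumes A: "A \<in> carrier_mat n n" and v: "v \<in> carrier_vec n"
  shows "mexp (x \<cdot>\<^sub>m A) *\<^sub>v v = expv A v x"
proof (rule eq_vecI)
  fix i assume i: "i < dim_vec (expv A v x)"
  then have i': "i < n" using A by simp
  have e: "mexp (x \<cdot>\<^sub>m A) $$ (i, j) = (\<Sum>k. (A ^\<^sub>m k) $$ (i, j) / fact k * x ^ k)"
    if "j < n" for j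
    using A i' that by (simp add: mexp_def pow_mat_smult[OF A] mult_ac)
  \<comment> \<open>Columns of the matrix exponential are exponentials acting on unit vectors; this
    yields summability of the entry series.\<close>
  have unit: "(A ^\<^sub>m k *\<^sub>v unit_vec n j) $ i = (A ^\<^sub>m k) $$ (i, j)" if "j < n" for k j
    using A i' that by simp
  have sm: "summable (\<lambda>k. (A ^\<^sub>m k) $$ (i, j) / fact k * x ^ k)" if "j < n" for j
    using summable_expv[OF A _ i', of "unit_vec n j" x] unit that by simp
  have "(mexp (x \<cdot>\<^sub>m A) *\<^sub>v v) $ i = (\<Sum>j<n. (\<Sum>k. (A ^\<^sub>m k) $$ (i, j) / fact k * x ^ k) * v $ j)"
    using A v i' by (subst index_mat_mult_vec_sum[of _ n n]) (auto simp: e)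
  also have "\<dots> = (\<Sum>j<n. \<Sum>k. (A ^\<^sub>m k) $$ (i, j) / fact k * x ^ k * v $ j)"
    by (intro sum.cong suminf_mult2 sm) auto
  also have "\<dots> = (\<Sum>k. \<Sum>j<n. (A ^\<^sub>m k) $$ (i, j) / fact k * x ^ k * v $ j)"
    by (intro suminf_sum[symmetric] summable_mult2 sm) auto
  also have "\<dots> = (\<Sum>k. (A ^\<^sub>m k *\<^sub>v v) $ i / fact k * x ^ k)"
    using A v i' by (subst index_mat_mult_vec_sum[of _ n n])
      (auto simp: sum_distrib_left sum_distrib_right sum_divide_distrib mult_ac)
  also have "\<dots> = expv A v x $ i" using A i' by (simp add: expv_def)
  finally show "(mexp (x \<cdot>\<^sub>m A) *\<^sub>v v) $ i = expv A v x $ i" .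
qed (use A in \<open>auto simp: mexp_def\<close>)

section \<open>Exponential decay\<close>

text \<open>Integrating factor: e^{-lx} g(x) has derivative e^{-lx} h(x), of size at most C e^{mx}
  with m = - Re l - e, so it grows no faster than a multiple of e^{mx}; multiplying back by e^{lx}
  leaves the rate -e. The strict inequality \<open>Re l < - e\<close> makes m positive and so
  excludes a resonant factor x.\<close>

lemma decay_linear_ode:
  fixes g h :: "real \<Rightarrow> complex" and l :: complex
  assumes g: "\<And>x. (g has_vector_derivative l * g x + h x) (at x)"
    and h: "\<And>x. x \<ge> 0 \<Longrightarrow> norm (h x) \<le> C * exp (- e * x)"
    and l: "Re l < - e"
  shows "\<exists>D. \<forall>x\<ge>0. norm (g x) \<le> D * exp (- e * x)"
proof -
  define m where "m = - Re l - e"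
  have m: "m > 0" using l by (simp add: m_def)
  have C: "C \<ge> 0" using order_trans[OF norm_ge_zero h[of 0]] by simp
  define G where "G s = exp (of_real s * - l) * g s" for s
  have G': "(G has_vector_derivative exp (of_real s * - l) * h s) (at s)" for s
  proof -
    have "((\<lambda>s. exp (of_real s * - l)) has_vector_derivative (exp (of_real s * - l) * - l)) (at s)"
      by (rule has_vector_derivative_real_field) (auto intro!: derivative_eq_intros)
    from has_vector_derivative_mult[OF this g[of s]] show ?thesis
      unfolding G_def by (simp add: algebra_simps)
  qed
  \<comment> \<open>Mean value inequality: the complex-valued \<open>G\<close> is compared with the
    real function (C/m) e^{mx}.\<close>
  have Gb: "norm (G x - G 0) \<le> C / m * exp (m * x) - C / m * exp (m * 0)" if x: "x > 0" for x
  proof (rule differentiable_bound_general[OF x, where \<phi>' = "\<lambda>s. C * exp (m * s)"])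
    show "continuous_on {0..x} G"
      using G' by (intro continuous_at_imp_continuous_on ballI has_vector_derivative_continuous) blast
    show "continuous_on {0..x} (\<lambda>s. C / m * exp (m * s))"
      by (intro continuous_intros)
    show "(G has_vector_derivative exp (of_real s * - l) * h s) (at s)" for s by (rule G')
    show "((\<lambda>s. C / m * exp (m * s)) has_vector_derivative C * exp (m * s)) (at s)" for s
      unfolding has_real_derivative_iff_has_vector_derivative[symmetric]
      using m by (auto intro!: derivative_eq_intros)
    show "norm (exp (of_real s * - l) * h s) \<le> C * exp (m * s)" if "0 < s" for s
    proof -
      have "norm (exp (of_real s * - l) * h s) \<le> exp (- Re l * s) * (C * exp (- e * s))"
        using h[of s] that by (simp add: norm_mult mult.commute)
      also have "\<dots> = C * exp (m * s)"
        by (simp add: m_def exp_add[symmetric] algebra_simps)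
      finally show ?thesis .
    qed
  qed
  have "norm (g x) \<le> (norm (g 0) + C / m) * exp (- e * x)" if x: "x \<ge> 0" for x
  proof (cases "x = 0")
    case True
    then show ?thesis using C m by simp
  next
    case False
    then have x: "x > 0" using that by simp
    have "norm (G x) \<le> norm (G 0) + norm (G x - G 0)" by norm
    also have "\<dots> \<le> norm (g 0) + C / m * exp (m * x)"
      using Gb[OF x] C m by (simp add: G_def) (smt (verit) divide_nonneg_pos)
    also have "\<dots> \<le> norm (g 0) * exp (m * x) + C / m * exp (m * x)"
      using m x by (simp add: mult_le_cancel_left1)
    finally have *: "norm (G x) \<le> (norm (g 0) + C / m) * exp (m * x)"
      by (simp add: algebra_simps)
    have "g x = exp (of_real x * l) * G x"
      by (simp add: G_def exp_minus field_simps)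
    then have "norm (g x) = exp (Re l * x) * norm (G x)"
      by (simp add: norm_mult mult.commute)
    also have "\<dots> \<le> exp (Re l * x) * ((norm (g 0) + C / m) * exp (m * x))"
      using * by (intro mult_left_mono) auto
    also have "\<dots> = (norm (g 0) + C / m) * exp (- e * x)"
      by (simp add: m_def exp_add[symmetric] algebra_simps)
    finally show ?thesis .
  qed
  then show ?thesis by blast
qed

text \<open>Back substitution from the last row: in row i the components k > i act as forcing, and
  they already decay at rate e by induction on \<open>n - i\<close>. One rate serves all rows
  because every diagonal entry lies strictly to the left of -e.\<close>

lemma expv_upper_triangular_decay:
  fixes U :: "complex mat"
  assumes U: "U \<in> carrier_mat n n" and ut: "upper_triangular U"
    and diag: "\<And>i. i < n \<Longrightarrow> Re (U $$ (i, i)) < - e"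
    and v: "v \<in> carrier_vec n" and i: "i < n"
  shows "\<exists>C. \<forall>x\<ge>0. norm (expv U v (of_real x) $ i) \<le> C * exp (- e * x)"
  using i
proof (induction "n - i" arbitrary: i rule: less_induct)
  case less
  have "\<forall>k\<in>{i<..<n}. \<exists>C. \<forall>x\<ge>0. norm (expv U v (of_real x) $ k) \<le> C * exp (- e * x)"
    by (intro ballI less.hyps) (use less.prems in auto)
  then obtain C where C: "\<And>k x. k \<in> {i<..<n} \<Longrightarrow> x \<ge> 0 \<Longrightarrow> norm (expv U v (of_real x) $ k) \<le> C k * exp (- e * x)"
    by metis
  define h where "h x = (\<Sum>k\<in>{i<..<n}. U $$ (i, k) * expv U v (of_real x) $ k)" for x :: real
  show ?case
  proof (rule decay_linear_ode[where h = h and C = "\<Sum>k\<in>{i<..<n}. norm (U $$ (i, k)) * C k"])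
    show "Re (U $$ (i, i)) < - e" using diag less.prems .
    fix x :: real
    have "(\<Sum>k<n. U $$ (i, k) * expv U v (of_real x) $ k)
        = (\<Sum>k\<in>insert i {i<..<n}. U $$ (i, k) * expv U v (of_real x) $ k)"
    proof (rule sum.mono_neutral_right)
      show "\<forall>k\<in>{..<n} - insert i {i<..<n}. U $$ (i, k) * expv U v (of_real x) $ k = 0"
        using upper_triangularD[OF ut, of _ i] U less.prems by (auto simp: not_less_iff_gr_or_eq)
    qed (use less.prems in auto)
    then have eq: "(\<Sum>k<n. U $$ (i, k) * expv U v (of_real x) $ k)
        = U $$ (i, i) * expv U v (of_real x) $ i + h x"
      by (simp add: h_def)
    show "((\<lambda>x. expv U v (of_real x) $ i) has_vector_derivative
        U $$ (i, i) * expv U v (of_real x) $ i + h x) (at x)"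
      using has_vector_derivative_real_field[OF DERIV_expv[OF U v less.prems, of "of_real x"]] eq by simp
    assume x: "x \<ge> 0"
    have "norm (h x) \<le> (\<Sum>k\<in>{i<..<n}. norm (U $$ (i, k)) * (C k * exp (- e * x)))"
      unfolding h_def by (rule order_trans[OF norm_sum], rule sum_mono, unfold norm_mult, intro mult_left_mono C x) auto
    then show "norm (h x) \<le> (\<Sum>k\<in>{i<..<n}. norm (U $$ (i, k)) * C k) * exp (- e * x)"
      by (simp add: sum_distrib_left mult_ac)
  qed
qed

lemma expv_of_real:
  fixes A :: "real mat"
  assumes A: "A \<in> carrier_mat n n" and v: "v \<in> carrier_vec n" and i: "i < n"
  shows "expv (map_mat complex_of_real A) (map_vec complex_of_real v) (of_real x) $ i
       = of_real (expv A v x $ i)"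
proof -
  have pow: "map_mat complex_of_real A ^\<^sub>m k *\<^sub>v map_vec complex_of_real v
      = map_vec complex_of_real (A ^\<^sub>m k *\<^sub>v v)" for k
  proof (induction k)
    case 0
    then show ?case using A v by simp
  next
    case (Suc k)
    have A': "map_mat complex_of_real A \<in> carrier_mat n n" and v': "map_vec complex_of_real v \<in> carrier_vec n"
      using A v by auto
    show ?case
      unfolding pow_mat_Suc_mult_vec'[OF A v] pow_mat_Suc_mult_vec'[OF A' v'] Suc
      by (rule of_real_hom.mult_mat_vec_hom[symmetric]) (use A v in auto)
  qed
  have idx: "map_vec complex_of_real (A ^\<^sub>m k *\<^sub>v v) $ i = of_real ((A ^\<^sub>m k *\<^sub>v v) $ i)" for k
    using A i by (simp del: index_mult_mat_vec)
  have "(\<Sum>k. of_real ((A ^\<^sub>m k *\<^sub>v v) $ i) / fact k * complex_of_real x ^ k)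
      = (\<Sum>k. complex_of_real ((A ^\<^sub>m k *\<^sub>v v) $ i / fact k * x ^ k))"
    by simp
  also have "\<dots> = of_real (\<Sum>k. (A ^\<^sub>m k *\<^sub>v v) $ i / fact k * x ^ k)"
    by (rule suminf_of_real[symmetric]) (rule summable_expv[OF A v i])
  finally show ?thesis
    using A i by (simp del: index_map_vec index_mult_mat_vec add: expv_def pow idx)
qed

text \<open>Hurwitz stability, the spectral clause of \<open>ME_triple\<close>, isolated because it
  passes from diagonal blocks to block triangular matrices.\<close>

definition stable :: "real mat \<Rightarrow> bool" where
  "stable A \<longleftrightarrow> (\<forall>k. eigenvalue (map_mat complex_of_real A) k \<longrightarrow> Re k < 0)"

lemma stable_expv_decay:
  assumes A: "A \<in> carrier_mat n n" and st: "stable A" and v: "v \<in> carrier_vec n" and i: "i < n"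
  shows "\<exists>C e. e > 0 \<and> (\<forall>x\<ge>0. \<bar>expv A v x $ i\<bar> \<le> C * exp (- e * x))"
proof -
  let ?A = "map_mat complex_of_real A" and ?v = "map_vec complex_of_real v"
  have A': "?A \<in> carrier_mat n n" and v': "?v \<in> carrier_vec n" using A v by auto
  obtain es where es: "char_poly ?A = (\<Prod>a\<leftarrow>es. [:- a, 1:])"
    using char_poly_factorized[OF A'] by blast
  obtain B P Q where dec: "schur_decomposition ?A es = (B, P, Q)"
    by (cases "schur_decomposition ?A es") auto
  from schur_decomposition[OF A' es dec] have sim: "similar_mat_wit ?A B P Q"
    and ut: "upper_triangular B" and diag: "diag_mat B = es" by auto
  note w = similar_mat_witD2[OF A' sim]
  have "Re a < 0" if "a \<in> set es" for a
  proof -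
    have "poly (char_poly ?A) a = 0"
      unfolding es using that by (auto simp: poly_prod_list prod_list_zero_iff)
    then show ?thesis using st eigenvalue_root_char_poly[OF A'] by (simp add: stable_def)
  qed
  then have neg: "Re (B $$ (i, i)) < 0" if "i < n" for i
    using that w(5) unfolding diag[symmetric] by (auto simp: diag_mat_def)
  \<comment> \<open>Half the distance from the spectrum to the imaginary axis, so that every
    diagonal entry satisfies the strict inequality of the triangular case. The set is nonempty
    because i < n.\<close>
  define e where "e = Min ((\<lambda>i. - Re (B $$ (i, i))) ` {..<n}) / 2"
  have ne: "(\<lambda>i. - Re (B $$ (i, i))) ` {..<n} \<noteq> {}" using i by auto
  have e0: "e > 0" using neg ne by (simp add: e_def Min_gr_iff)
  have e: "Re (B $$ (i, i)) < - e" if "i < n" for i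
  proof -
    have "Min ((\<lambda>i. - Re (B $$ (i, i))) ` {..<n}) \<le> - Re (B $$ (i, i))"
      using that by (intro Min_le) auto
    then show ?thesis using e0 by (simp add: e_def)
  qed
  have Qv: "Q *\<^sub>v ?v \<in> carrier_vec n" using w v' by auto
  have eq: "P *\<^sub>v expv B (Q *\<^sub>v ?v) z = expv ?A ?v z" for z
  proof (rule mult_mat_vec_expv[OF w(5) Qv v' w(6) A'])
    fix k
    have Bk: "B ^\<^sub>m k \<in> carrier_mat n n" using w(5) by simp
    show "P *\<^sub>v (B ^\<^sub>m k *\<^sub>v (Q *\<^sub>v ?v)) = ?A ^\<^sub>m k *\<^sub>v ?v"
      unfolding similar_mat_wit_pow_id[OF sim]
      using w(6,7) Bk v' by (simp add: assoc_mult_mat_vec[of _ n n _ n])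
  qed
  have "\<forall>k\<in>{..<n}. \<exists>C. \<forall>x\<ge>0. norm (expv B (Q *\<^sub>v ?v) (of_real x) $ k) \<le> C * exp (- e * x)"
    using expv_upper_triangular_decay[OF w(5) ut e Qv] by blast
  then obtain C where C: "\<And>k x. k < n \<Longrightarrow> x \<ge> 0 \<Longrightarrow>
      norm (expv B (Q *\<^sub>v ?v) (of_real x) $ k) \<le> C k * exp (- e * x)"
    by (metis lessThan_iff)
  have "\<bar>expv A v x $ i\<bar> \<le> (\<Sum>k<n. norm (P $$ (i, k)) * C k) * exp (- e * x)" if x: "x \<ge> 0" for x
  proof -
    have "\<bar>expv A v x $ i\<bar> = norm (expv ?A ?v (of_real x) $ i)"
      unfolding expv_of_real[OF A v i] by simp
    also have "\<dots> = norm (\<Sum>k<n. P $$ (i, k) * expv B (Q *\<^sub>v ?v) (of_real x) $ k)"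
      unfolding eq[symmetric] by (subst index_mat_mult_vec_sum[OF w(6) _ i]) (use w(5) in auto)
    also have "\<dots> \<le> (\<Sum>k<n. norm (P $$ (i, k)) * (C k * exp (- e * x)))"
      by (rule order_trans[OF norm_sum], rule sum_mono, unfold norm_mult, intro mult_left_mono C x) auto
    finally show ?thesis by (simp add: sum_distrib_left mult_ac)
  qed
  with e0 show ?thesis by blast
qed

text \<open>These limits remove the boundary terms at infinity in the integrations by parts.\<close>

lemma stable_power_expv_tendsto_0:
  assumes A: "A \<in> carrier_mat n n" and st: "stable A" and v: "v \<in> carrier_vec n" and u: "u \<in> carrier_vec n"
  shows "((\<lambda>x. x ^ k * (u \<bullet> expv A v x)) \<longlongrightarrow> 0) at_top"
proof -
  have comp: "((\<lambda>x. x ^ k * expv A v x $ i) \<longlongrightarrow> 0) at_top" if i: "i < n" for i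
  proof -
    obtain C e where e: "e > 0" and C: "\<And>x. x \<ge> 0 \<Longrightarrow> \<bar>expv A v x $ i\<bar> \<le> C * exp (- e * x)"
      using stable_expv_decay[OF A st v i] by blast
    have "((\<lambda>x. x ^ k * exp (- e * x)) \<longlongrightarrow> 0) at_top"
      using e by real_asymp
    then have "((\<lambda>x. C * (x ^ k * exp (- e * x))) \<longlongrightarrow> 0) at_top"
      by (rule tendsto_mult_right_zero)
    then show ?thesis
    proof (rule Lim_null_comparison[rotated])
      show "\<forall>\<^sub>F x in at_top. norm (x ^ k * expv A v x $ i) \<le> C * (x ^ k * exp (- e * x))"
        using eventually_ge_at_top[of 0]
      proof eventually_elim
        case (elim x)
        have "\<bar>x\<bar> ^ k * \<bar>expv A v x $ i\<bar> \<le> x ^ k * (C * exp (- e * x))"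
          using elim C by (intro mult_mono) auto
        then show ?case by (simp add: abs_mult power_abs mult_ac)
      qed
    qed
  qed
  have "((\<lambda>x. \<Sum>i<n. u $ i * (x ^ k * expv A v x $ i)) \<longlongrightarrow> (\<Sum>i<n. u $ i * 0)) at_top"
    by (intro tendsto_sum tendsto_mult tendsto_const comp) auto
  then show ?thesis
    using A u by (simp add: scalar_prod_sum[of u n] sum_distrib_left mult_ac)
qed

section \<open>Inverse and block structure\<close>

text \<open>Zero is not an eigenvalue, so A is invertible. As \<open>minv\<close> is a definite
  description, its properties become available only after both existence and uniqueness; the witness
  is \<open>- B\<close> for the inverse \<open>B\<close> of A.\<close>

lemma stable_minv:
  assumes A: "A \<in> carrier_mat n n" and st: "stable A"
  shows "minv (- A) \<in> carrier_mat n n" and "- A * minv (- A) = 1\<^sub>m n" and "minv (- A) * - A = 1\<^sub>m n"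
proof -
  have "det A \<noteq> 0"
  proof
    assume "det A = 0"
    then have "det (map_mat complex_of_real A) = 0" by (simp add: of_real_hom.hom_det)
    then obtain v where "v \<in> carrier_vec n" "v \<noteq> 0\<^sub>v n" "map_mat complex_of_real A *\<^sub>v v = 0\<^sub>v n"
      using det_0_iff_vec_prod_zero_field[of "map_mat complex_of_real A" n] A by auto
    then have "eigenvalue (map_mat complex_of_real A) 0"
      unfolding eigenvalue_def eigenvector_def using A by (intro exI[of _ v]) auto
    then show False using st by (auto simp: stable_def)
  qed
  from det_non_zero_imp_unit[OF A this, of "()"] obtain B where
    B: "B \<in> carrier_mat n n" "B * A = 1\<^sub>m n" "A * B = 1\<^sub>m n"
    by (auto simp: Units_def ring_mat_simps)
  have "\<exists>!B. B \<in> carrier_mat n n \<and> - A * B = 1\<^sub>m n \<and> B * - A = 1\<^sub>m n"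
  proof (rule ex1I[of _ "- B"])
    show *: "- B \<in> carrier_mat n n \<and> - A * - B = 1\<^sub>m n \<and> - B * - A = 1\<^sub>m n"
      using A B by simp
    fix C assume C: "C \<in> carrier_mat n n \<and> - A * C = 1\<^sub>m n \<and> C * - A = 1\<^sub>m n"
    have "C = C * (- A * - B)"
      unfolding conjunct1[OF conjunct2[OF *]] by (rule right_mult_one_mat[symmetric]) (use C in auto)
    also have "\<dots> = (C * - A) * - B"
      by (rule assoc_mult_mat[symmetric, of _ n n _ n _ n]) (use A B C in auto)
    also have "\<dots> = - B" using C B by simp
    finally show "C = - B" .
  qed
  from theI'[OF this] have "minv (- A) \<in> carrier_mat n n \<and> - A * minv (- A) = 1\<^sub>m n \<and> minv (- A) * - A = 1\<^sub>m n"
    unfolding minv_def using A by simp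
  then show "minv (- A) \<in> carrier_mat n n" and "- A * minv (- A) = 1\<^sub>m n" and "minv (- A) * - A = 1\<^sub>m n"
    by auto
qed

text \<open>The characteristic polynomial is the product of those of the diagonal blocks, so no new
  eigenvalues arise. The product formula is applied over the complex numbers, where both factors
  split as it requires.\<close>

lemma stable_four_block_mat:
  assumes A: "A \<in> carrier_mat n n" and B: "B \<in> carrier_mat n m" and D: "D \<in> carrier_mat m m"
    and "stable A" "stable D"
  shows "stable (four_block_mat A B (0\<^sub>m m n) D)"
  unfolding stable_def
proof (intro allI impI)
  fix k
  let ?c = "map_mat complex_of_real"
  assume ev: "eigenvalue (?c (four_block_mat A B (0\<^sub>m m n) D)) k"
  have eq: "?c (four_block_mat A B (0\<^sub>m m n) D) = four_block_mat (?c A) (?c B) (0\<^sub>m m n) (?c D)"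
  proof -
    have "?c (0\<^sub>m m n) = 0\<^sub>m m n" by (intro eq_matI) auto
    then show ?thesis using map_four_block_mat[OF A B _ D, of "0\<^sub>m m n" complex_of_real] by simp
  qed
  have cs: "?c A \<in> carrier_mat n n" "?c B \<in> carrier_mat n m" "?c D \<in> carrier_mat m m" using A B D by auto
  have "char_poly (?c (four_block_mat A B (0\<^sub>m m n) D)) = char_poly (?c A) * char_poly (?c D)"
    using char_poly_0_block[OF eq _ _ cs(1,2,3)] char_poly_factorized[OF cs(1)] char_poly_factorized[OF cs(3)]
    by blast
  then have "eigenvalue (?c A) k \<or> eigenvalue (?c D) k"
    using ev eigenvalue_root_char_poly[OF cs(1)] eigenvalue_root_char_poly[OF cs(3)]
      eigenvalue_root_char_poly[of "?c (four_block_mat A B (0\<^sub>m m n) D)" "n + m"] A D by simp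
  then show "Re k < 0" using assms(4,5) by (auto simp: stable_def)
qed

section \<open>Block triangular systems and convolution\<close>

lemma sum_lessThan_add:
  fixes f :: "nat \<Rightarrow> 'a :: comm_monoid_add"
  shows "(\<Sum>k<n + m. f k) = (\<Sum>k<n. f k) + (\<Sum>k<m. f (n + k))"
  by (induction m) (auto simp: add.assoc)

text \<open>The zero block decouples the lower coordinates, which evolve under \<open>D\<close>
  alone.\<close>

lemma four_block_mat_pow_append_vec:
  assumes A: "A \<in> carrier_mat n n" and B: "B \<in> carrier_mat n m" and D: "(D :: 'a :: comm_semiring_1 mat) \<in> carrier_mat m m"
    and w: "w \<in> carrier_vec n" and z: "z \<in> carrier_vec m" and j: "j < m"
  shows "(four_block_mat A B (0\<^sub>m m n) D ^\<^sub>m k *\<^sub>v (w @\<^sub>v z)) $ (n + j) = (D ^\<^sub>m k *\<^sub>v z) $ j"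
  using j
proof (induction k arbitrary: j)
  case 0
  then show ?case using assms by simp
next
  case (Suc k)
  let ?T = "four_block_mat A B (0\<^sub>m m n) D"
  have T: "?T \<in> carrier_mat (n + m) (n + m)" using A D by auto
  have wz: "w @\<^sub>v z \<in> carrier_vec (n + m)" using w z by auto
  have "(?T ^\<^sub>m Suc k *\<^sub>v (w @\<^sub>v z)) $ (n + j) = (\<Sum>l<n + m. ?T $$ (n + j, l) * (?T ^\<^sub>m k *\<^sub>v (w @\<^sub>v z)) $ l)"
    unfolding pow_mat_Suc_mult_vec'[OF T wz]
    by (rule index_mat_mult_vec_sum[OF T]) (use T wz Suc.prems in auto)
  also have "\<dots> = (\<Sum>l<m. D $$ (j, l) * (D ^\<^sub>m k *\<^sub>v z) $ l)"
    unfolding sum_lessThan_add using A D Suc.prems Suc.IH by (simp del: index_mult_mat_vec)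
  also have "\<dots> = (D ^\<^sub>m Suc k *\<^sub>v z) $ j"
    unfolding pow_mat_Suc_mult_vec'[OF D z]
    by (rule index_mat_mult_vec_sum[OF D, symmetric]) (use D z Suc.prems in auto)
  finally show ?case .
qed

text \<open>The upper coordinates y of e^{sT} (0,z) solve y' = A y + b (c e^{sD} z), so by variation
  of constants a e^{(x-s)A} y(s) is an antiderivative of the convolution integrand, running from 0
  to the block expression as s goes from 0 to x. Stating the antiderivative instead of an integral
  lets one function deliver both the sign and the value of the convolution.\<close>

lemma expv_block_convolution:
  fixes A D :: "real mat"
  assumes A: "A \<in> carrier_mat n n" and a: "a \<in> carrier_vec n" and b: "b \<in> carrier_vec n"
    and D: "D \<in> carrier_mat m m" and c: "c \<in> carrier_vec m" and z: "z \<in> carrier_vec m"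
  defines "T \<equiv> four_block_mat A (mat n m (\<lambda>(i, j). b $ i * c $ j)) (0\<^sub>m m n) D"
  obtains \<phi> where "\<phi> 0 = 0" and "\<phi> x = (a @\<^sub>v 0\<^sub>v m) \<bullet> expv T (0\<^sub>v n @\<^sub>v z) x"
    and "\<And>s. (\<phi> has_field_derivative (a \<bullet> expv A b (x - s)) * (c \<bullet> expv D z s)) (at s)"
proof -
  let ?B = "mat n m (\<lambda>(i, j). b $ i * c $ j)"
  define v where "v = 0\<^sub>v n @\<^sub>v z"
  have B: "?B \<in> carrier_mat n m" by simp
  have T: "T \<in> carrier_mat (n + m) (n + m)" using A D by (auto simp: T_def)
  have v: "v \<in> carrier_vec (n + m)" using z by (auto simp: v_def)
  have low: "expv T v s $ (n + j) = expv D z s $ j" if "j < m" for j s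
  proof -
    have "(T ^\<^sub>m k *\<^sub>v v) $ (n + j) = (D ^\<^sub>m k *\<^sub>v z) $ j" for k
      unfolding T_def v_def by (rule four_block_mat_pow_append_vec[OF A B D _ z that]) simp
    then show ?thesis using T D that by (simp del: index_mult_mat_vec add: expv_def)
  qed
  define \<phi> where "\<phi> s = expv (transpose_mat A) a (x - s) \<bullet> vec n (\<lambda>i. expv T v s $ i)" for s
  have At: "transpose_mat A \<in> carrier_mat n n" using A by simp
  have "vec n (\<lambda>i. expv T v 0 $ i) = 0\<^sub>v n"
    unfolding expv_0[OF T v] by (auto simp: v_def)
  then have "\<phi> 0 = 0" using A by (simp add: \<phi>_def)
  moreover have "\<phi> x = (a @\<^sub>v 0\<^sub>v m) \<bullet> expv T v x"
  proof -
    have "(a @\<^sub>v 0\<^sub>v m) \<bullet> expv T v x = (\<Sum>i<n. a $ i * expv T v x $ i)"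
      using T a by (subst scalar_prod_sum[of _ "n + m"]) (auto simp: sum_lessThan_add)
    also have "\<dots> = \<phi> x"
      using a by (simp add: \<phi>_def expv_0[OF At a] scalar_prod_sum[of a n])
    finally show ?thesis ..
  qed
  moreover have "(\<phi> has_field_derivative (a \<bullet> expv A b (x - s)) * (c \<bullet> expv D z s)) (at s)" for s
    unfolding \<phi>_def
  proof (rule DERIV_variation_of_constants[OF A b a])
    fix i assume i: "i < n"
    \<comment> \<open>The coupling block has rank one, so it contributes to upper row i the entry
      b_i times one scalar function, the forcing term required by variation of constants.\<close>
    have "(\<Sum>k<n + m. T $$ (i, k) * expv T v s $ k)
        = (\<Sum>k<n. A $$ (i, k) * expv T v s $ k) + (\<Sum>k<m. b $ i * (c $ k * expv D z s $ k))"
      unfolding sum_lessThan_add using A D i low by (simp add: T_def mult_ac)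
    also have "(\<Sum>k<m. b $ i * (c $ k * expv D z s $ k)) = b $ i * (c \<bullet> expv D z s)"
      using D c by (simp add: scalar_prod_sum[of c m] sum_distrib_left)
    finally show "((\<lambda>s. expv T v s $ i) has_field_derivative
        (\<Sum>k<n. A $$ (i, k) * expv T v s $ k) + b $ i * (c \<bullet> expv D z s)) (at s)"
      using DERIV_expv[OF T v, of i s] i by simp
  qed
  ultimately show ?thesis using that unfolding v_def by blast
qed

section \<open>Moments of matrix-exponential functions\<close>

lemma expv_uminus:
  fixes A :: "'a :: {real_normed_field, banach} mat"
  assumes A: "A \<in> carrier_mat n n" and v: "v \<in> carrier_vec n"
  shows "expv A (- v) z = - expv A v z"
proof (rule eq_vecI)
  fix i assume "i < dim_vec (- expv A v z)"
  then have i: "i < n" using A by simp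
  have "(A ^\<^sub>m k *\<^sub>v (- v)) $ i / fact k * z ^ k = - ((A ^\<^sub>m k *\<^sub>v v) $ i / fact k * z ^ k)" for k
    using A v i by simp
  then show "expv A (- v) z $ i = (- expv A v z) $ i"
    using A i suminf_minus[OF summable_expv[OF A v i]] by (simp del: index_mult_mat_vec add: expv_def)
qed (use A in auto)

text \<open>A maps (-A)^{-1} v to -v, so inserting (-A)^{-1} integrates the exponential up to
  sign.\<close>

lemma DERIV_expv_minv:
  assumes A: "A \<in> carrier_mat n n" and st: "stable A" and u: "u \<in> carrier_vec n" and v: "v \<in> carrier_vec n"
  shows "((\<lambda>x. u \<bullet> expv A (minv (- A) *\<^sub>v v) x) has_field_derivative - (u \<bullet> expv A v x)) (at x)"
proof -
  note N = stable_minv[OF A st]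
  define w where "w = minv (- A) *\<^sub>v v"
  have w: "w \<in> carrier_vec n" using N v by (auto simp: w_def)
  have "- A *\<^sub>v w = v"
    using N A v by (simp add: w_def assoc_mult_mat_vec[of _ n n _ n, symmetric] del: uminus_mult_mat_vec)
  then have "A *\<^sub>v w = - v"
    using A w by (simp add: uminus_mult_mat_vec) (metis uminus_uminus_vec)
  then have "u \<bullet> expv A (A *\<^sub>v w) x = - (u \<bullet> expv A v x)"
    using A u by (simp add: expv_uminus[OF A v])
  then show ?thesis
    using DERIV_scalar_prod_expv[OF A w u, of x] by (simp add: w_def)
qed

text \<open>Integration by parts as a recursion on antiderivatives; each step replaces v by
  (-A)^{-1} v, hence \<open>v\<close> is arbitrary in the induction. The normalisation at infinity
  makes \<open>- G 0\<close> the moment over the half-line.\<close>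

lemma power_expv_antiderivative:
  assumes A: "A \<in> carrier_mat n n" and st: "stable A" and u: "u \<in> carrier_vec n" and v: "v \<in> carrier_vec n"
  shows "\<exists>G. (\<forall>x. (G has_field_derivative x ^ r * (u \<bullet> expv A v x)) (at x)) \<and>
    (G \<longlongrightarrow> 0) at_top \<and> G 0 = - (fact r * (u \<bullet> (minv (- A) ^\<^sub>m (r + 1) *\<^sub>v v)))"
  using v
proof (induction r arbitrary: v)
  case (0 v)
  note N = stable_minv[OF A st]
  define w where "w = minv (- A) *\<^sub>v v"
  have w: "w \<in> carrier_vec n" using N 0 by (auto simp: w_def)
  have "((\<lambda>x. - (u \<bullet> expv A w x)) has_field_derivative x ^ 0 * (u \<bullet> expv A v x)) (at x)" for x
    using DERIV_minus[OF DERIV_expv_minv[OF A st u 0, of x]] by (simp add: w_def)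
  moreover have "((\<lambda>x. - (u \<bullet> expv A w x)) \<longlongrightarrow> 0) at_top"
    using tendsto_minus[OF stable_power_expv_tendsto_0[OF A st w u, of 0]] by simp
  moreover have "- (u \<bullet> expv A w 0) = - (fact 0 * (u \<bullet> (minv (- A) ^\<^sub>m (0 + 1) *\<^sub>v v)))"
    using N expv_0[OF A w] by (simp add: w_def)
  ultimately show ?case by (intro exI[of _ "\<lambda>x. - (u \<bullet> expv A w x)"]) blast
next
  case (Suc r v)
  note N = stable_minv[OF A st]
  define w where "w = minv (- A) *\<^sub>v v"
  have w: "w \<in> carrier_vec n" using N Suc.prems by (auto simp: w_def)
  from Suc.IH[OF w] obtain G where G: "\<And>x. (G has_field_derivative x ^ r * (u \<bullet> expv A w x)) (at x)"
    "(G \<longlongrightarrow> 0) at_top" "G 0 = - (fact r * (u \<bullet> (minv (- A) ^\<^sub>m (r + 1) *\<^sub>v w)))"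
    by blast
  \<comment> \<open>Boundary term plus the remaining integral; on differentiation the two terms with
    x^r cancel.\<close>
  define H where "H x = real (Suc r) * G x - x ^ Suc r * (u \<bullet> expv A w x)" for x
  have w': "((\<lambda>x. u \<bullet> expv A w x) has_field_derivative - (u \<bullet> expv A v x)) (at x)" for x
    unfolding w_def by (rule DERIV_expv_minv[OF A st u Suc.prems])
  have pw: "((\<lambda>x. x ^ Suc r) has_field_derivative real (Suc r) * x ^ r) (at x)" for x :: real
    using DERIV_pow[of "Suc r" x UNIV] by simp
  have "(H has_field_derivative x ^ Suc r * (u \<bullet> expv A v x)) (at x)" for x
    using DERIV_diff[OF DERIV_cmult[OF G(1)] DERIV_mult[OF pw w'], of "real (Suc r)" x]
    unfolding H_def by (simp add: algebra_simps)
  moreover have "(H \<longlongrightarrow> 0) at_top"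
    using tendsto_diff[OF tendsto_mult_right_zero[OF G(2), of "real (Suc r)"]
        stable_power_expv_tendsto_0[OF A st w u, of "Suc r"]]
    unfolding H_def by simp
  moreover have "H 0 = - (fact (Suc r) * (u \<bullet> (minv (- A) ^\<^sub>m (Suc r + 1) *\<^sub>v v)))"
    using pow_mat_Suc_mult_vec[OF N(1) Suc.prems, of "Suc r"]
    by (simp add: H_def G(3) w_def mult_ac del: pow_mat.simps of_nat_Suc)
  ultimately show ?case by blast
qed

section \<open>Matrix-exponential functions: shift, continuity and tail moments\<close>

lemma ME_tripleD:
  assumes "ME_triple a A b"
  obtains n where "a \<in> carrier_vec n" "A \<in> carrier_mat n n" "b \<in> carrier_vec n" "stable A"
  using assms unfolding ME_triple_def stable_def by (metis carrier_vec_dim_vec carrier_vecI)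

lemma ME_triple_iff:
  assumes "a \<in> carrier_vec n" "A \<in> carrier_mat n n" "b \<in> carrier_vec n"
  shows "ME_triple a A b \<longleftrightarrow> stable A"
  using assms by (auto simp: ME_triple_def stable_def)

lemma ME_fun_eq_expv:
  assumes "a \<in> carrier_vec n" "A \<in> carrier_mat n n" "b \<in> carrier_vec n"
  shows "ME_fun a A b x = a \<bullet> expv A b x"
  using assms by (simp add: ME_fun_def mexp_smult_mult_vec)

text \<open>The semigroup law moves the shift d into the row vector, which becomes, up to scaling,
  the residual-life vector \<open>alphaRL\<close>. Row vectors are stored as \<open>vec\<close>,
  hence the transpose.\<close>

lemma ME_fun_add:
  assumes a: "a \<in> carrier_vec n" and A: "A \<in> carrier_mat n n" and b: "b \<in> carrier_vec n"
  shows "ME_fun a A b (d + x) = (transpose_mat (mexp (d \<cdot>\<^sub>m A)) *\<^sub>v a) \<bullet> expv A b x"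
proof -
  have E: "mexp (d \<cdot>\<^sub>m A) \<in> carrier_mat n n" using A by auto
  show ?thesis
    unfolding transpose_vec_mult_scalar[OF E expv_carrier[OF A] a] ME_fun_eq_expv[OF a A b]
      mexp_smult_mult_vec[OF A expv_carrier[OF A]] scalar_prod_expv_expv[OF A b a] ..
qed

lemma continuous_ME_fun:
  assumes "ME_triple a A b"
  shows "continuous_on S (ME_fun a A b)"
proof -
  from assms obtain n where *: "a \<in> carrier_vec n" "A \<in> carrier_mat n n" "b \<in> carrier_vec n"
    by (rule ME_tripleD)
  have "continuous_on S (\<lambda>x. a \<bullet> expv A b x)"
    using DERIV_scalar_prod_expv[OF *(2,3,1)]
    by (intro continuous_at_imp_continuous_on ballI DERIV_isCont) blast
  moreover have "ME_fun a A b = (\<lambda>x. a \<bullet> expv A b x)" using ME_fun_eq_expv[OF *] by auto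
  ultimately show ?thesis by simp
qed

lemma borel_measurable_ME_fun:
  assumes "ME_triple a A b"
  shows "ME_fun a A b \<in> borel_measurable borel"
  by (rule borel_measurable_continuous_onI) (rule continuous_ME_fun[OF assms])

text \<open>The shifted antiderivative G(x - d) increases to 0 on the half-line from d, so the tail
  integral is -G(0). The sign of \<open>m\<close> is a separate claim because the equation in
  \<open>ennreal\<close> cannot tell a negative \<open>m\<close> from 0.\<close>

lemma nn_integral_ME_fun_tail:
  fixes r :: nat
  assumes trip: "ME_triple a A b" and nonneg: "\<And>x. x \<ge> 0 \<Longrightarrow> 0 \<le> ME_fun a A b x" and d: "d \<ge> 0"
  defines "m \<equiv> fact r * ((transpose_mat (mexp (d \<cdot>\<^sub>m A)) *\<^sub>v a) \<bullet> (minv (- A) ^\<^sub>m (r + 1) *\<^sub>v b))"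
  shows "(\<integral>\<^sup>+x. ennreal ((x - d) ^ r * ME_fun a A b x) * indicator {d..} x \<partial>lborel) = ennreal m"
    and "m \<ge> 0"
proof -
  from trip obtain n where a: "a \<in> carrier_vec n" and A: "A \<in> carrier_mat n n" and b: "b \<in> carrier_vec n"
    and st: "stable A" by (rule ME_tripleD)
  define w where "w = transpose_mat (mexp (d \<cdot>\<^sub>m A)) *\<^sub>v a"
  have w: "w \<in> carrier_vec n" unfolding w_def using A a
    by (intro mult_mat_vec_carrier[of _ n n]) auto
  obtain G where G: "\<And>x. (G has_field_derivative x ^ r * (w \<bullet> expv A b x)) (at x)"
    "(G \<longlongrightarrow> 0) at_top" "G 0 = - m"
    using power_expv_antiderivative[OF A st w b, of r] unfolding m_def w_def by blast
  have F: "ME_fun a A b x = w \<bullet> expv A b (x - d)" for x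
    using ME_fun_add[OF a A b, of d "x - d"] by (simp add: w_def)
  have G': "((\<lambda>x. G (x - d)) has_field_derivative (x - d) ^ r * ME_fun a A b x) (at x)" for x
    using DERIV_shift[of G "(x - d) ^ r * ME_fun a A b x" x "- d"] G(1)[of "x - d"] by (simp add: F)
  have lim: "((\<lambda>x. G (x - d)) \<longlongrightarrow> 0) at_top"
    by (rule filterlim_compose[OF G(2)]) real_asymp
  have pos: "0 \<le> (x - d) ^ r * ME_fun a A b x" if "d \<le> x" for x
    using that d by (intro mult_nonneg_nonneg nonneg) auto
  have meas: "(\<lambda>x. (x - d) ^ r * ME_fun a A b x) \<in> borel_measurable borel"
    using borel_measurable_ME_fun[OF trip] by measurable
  show "(\<integral>\<^sup>+x. ennreal ((x - d) ^ r * ME_fun a A b x) * indicator {d..} x \<partial>lborel) = ennreal m"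
    using nn_integral_FTC_atLeast[OF meas G' pos lim] G(3) by simp
  have "G (d - d) \<le> 0"
  proof (rule tendsto_lowerbound[OF lim])
    show "\<forall>\<^sub>F x in at_top. G (d - d) \<le> G (x - d)"
      using eventually_ge_at_top[of d]
    proof eventually_elim
      case (elim x)
      show ?case
        by (rule DERIV_nonneg_imp_nondecreasing[OF elim, where f = "\<lambda>x. G (x - d)"])
           (metis G' pos)
    qed
  qed simp
  then show "m \<ge> 0" using G(3) by simp
qed

section \<open>Sums of independent matrix-exponential variables\<close>

text \<open>With extension by 0, a convolution over the whole line restricts itself to
  [0,s].\<close>

definition ME_pdf :: "real vec \<times> real mat \<times> real vec \<Rightarrow> real \<Rightarrow> real" where
  "ME_pdf c x = (case c of (a, A, b) \<Rightarrow> if 0 \<le> x then ME_fun a A b x else 0)"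

text \<open>The invariant of the block recursion: stability and nonnegativity both survive
  convolution.\<close>

definition ME_nonneg :: "real vec \<times> real mat \<times> real vec \<Rightarrow> bool" where
  "ME_nonneg c \<longleftrightarrow> (case c of (a, A, b) \<Rightarrow> ME_triple a A b \<and> (\<forall>x\<ge>0. 0 \<le> ME_fun a A b x))"

lemma ME_pdf_nonneg: "ME_nonneg c \<Longrightarrow> 0 \<le> ME_pdf c x"
  by (cases c) (simp add: ME_nonneg_def ME_pdf_def)

lemma borel_measurable_ME_pdf: "ME_nonneg c \<Longrightarrow> ME_pdf c \<in> borel_measurable borel"
proof (cases c)
  case (fields a A b)
  assume "ME_nonneg c"
  with fields have [measurable]: "ME_fun a A b \<in> borel_measurable borel"
    by (auto simp: ME_nonneg_def intro: borel_measurable_ME_fun)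
  have "(\<lambda>x. if 0 \<le> x then ME_fun a A b x else 0) \<in> borel_measurable borel" by measurable
  then show ?thesis using fields by (simp add: ME_pdf_def[abs_def])
qed

text \<open>The antiderivative of the convolution integrand starts at 0 and is nondecreasing, so its
  end value, the block function, is nonnegative; the fundamental theorem identifies that value with
  the convolution.\<close>

lemma blk_Cons_convolution:
  assumes c: "ME_nonneg c" and B: "ME_nonneg (blk cs)" and cs: "cs \<noteq> []"
  shows "ME_nonneg (blk (c # cs))"
    and "(\<integral>\<^sup>+y. ennreal (ME_pdf c (s - y)) * ennreal (ME_pdf (blk cs) y) \<partial>lborel) = ennreal (ME_pdf (blk (c # cs)) s)"
proof -
  obtain a A b where c_eq: "c = (a, A, b)" by (cases c)
  obtain a' D z where B_eq: "blk cs = (a', D, z)" by (cases "blk cs")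
  from c obtain n where a: "a \<in> carrier_vec n" and A: "A \<in> carrier_mat n n" and b: "b \<in> carrier_vec n"
    and stA: "stable A" unfolding c_eq ME_nonneg_def by (auto elim: ME_tripleD)
  from B obtain m where a': "a' \<in> carrier_vec m" and D: "D \<in> carrier_mat m m" and z: "z \<in> carrier_vec m"
    and stD: "stable D" unfolding B_eq ME_nonneg_def by (auto elim: ME_tripleD)
  define T where "T = four_block_mat A (mat n m (\<lambda>(i, j). b $ i * a' $ j)) (0\<^sub>m m n) D"
  define \<alpha> where "\<alpha> = a @\<^sub>v 0\<^sub>v m"
  define v where "v = 0\<^sub>v n @\<^sub>v z"
  \<comment> \<open>\<open>blk\<close> treats one-element lists separately; its recursive equation
    fires only for a nonempty tail.\<close>
  have eq: "blk (c # cs) = (\<alpha>, T, v)"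
    using cs B_eq a a' unfolding c_eq \<alpha>_def T_def v_def by (cases cs) auto
  have T: "T \<in> carrier_mat (n + m) (n + m)" using A D by (auto simp: T_def)
  have \<alpha>: "\<alpha> \<in> carrier_vec (n + m)" using a by (auto simp: \<alpha>_def)
  have v: "v \<in> carrier_vec (n + m)" using z by (auto simp: v_def)
  have "stable T"
    unfolding T_def by (rule stable_four_block_mat[OF A _ D stA stD]) simp
  then have trip: "ME_triple \<alpha> T v"
    by (simp add: ME_triple_iff[OF \<alpha> T v])
  have trips: "ME_triple a A b" "ME_triple a' D z"
    using c B by (auto simp: ME_nonneg_def c_eq B_eq)
  have pos: "0 \<le> ME_fun a A b x * ME_fun a' D z y" if "0 \<le> x" "0 \<le> y" for x y
    using c B that by (auto simp: ME_nonneg_def c_eq B_eq)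
  have ex: "\<exists>\<phi>. \<phi> 0 = 0 \<and> \<phi> x = ME_fun \<alpha> T v x \<and>
      (\<forall>s. (\<phi> has_field_derivative ME_fun a A b (x - s) * ME_fun a' D z s) (at s))" for x
    unfolding ME_fun_eq_expv[OF a A b] ME_fun_eq_expv[OF a' D z] ME_fun_eq_expv[OF \<alpha> T v]
    unfolding \<alpha>_def T_def v_def by (rule expv_block_convolution[OF A a b D a' z, of x]) blast
  have conv: "(\<integral>\<^sup>+y. ennreal (ME_fun a A b (x - y) * ME_fun a' D z y) * indicator {0..x} y \<partial>lborel)
      = ennreal (ME_fun \<alpha> T v x) \<and> 0 \<le> ME_fun \<alpha> T v x" if x: "0 \<le> x" for x
  proof -
    from ex[of x] obtain \<phi> where \<phi>: "\<phi> 0 = 0" "\<phi> x = ME_fun \<alpha> T v x"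
      "\<And>s. (\<phi> has_field_derivative ME_fun a A b (x - s) * ME_fun a' D z s) (at s)" by blast
    have [measurable]: "ME_fun a A b \<in> borel_measurable borel" "ME_fun a' D z \<in> borel_measurable borel"
      using trips by (auto intro: borel_measurable_ME_fun)
    have meas: "(\<lambda>y. ME_fun a A b (x - y) * ME_fun a' D z y) \<in> borel_measurable borel" by measurable
    have "\<phi> 0 \<le> \<phi> x"
    proof (rule DERIV_nonneg_imp_nondecreasing[OF x])
      fix s assume "0 \<le> s" "s \<le> x"
      then show "\<exists>y. (\<phi> has_field_derivative y) (at s) \<and> 0 \<le> y"
        using \<phi>(3)[of s] pos[of "x - s" s] by auto
    qed
    moreover have "(\<integral>\<^sup>+y. ennreal (ME_fun a A b (x - y) * ME_fun a' D z y) * indicator {0..x} y \<partial>lborel)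
        = ennreal (\<phi> x - \<phi> 0)"
      by (rule nn_integral_FTC_Icc[OF meas _ _ x]) (rule \<phi>(3), rule pos, auto)
    ultimately show ?thesis using \<phi>(1,2) by simp
  qed
  show "ME_nonneg (blk (c # cs))"
    unfolding eq ME_nonneg_def using trip conv by auto
  show "(\<integral>\<^sup>+y. ennreal (ME_pdf c (s - y)) * ennreal (ME_pdf (blk cs) y) \<partial>lborel) = ennreal (ME_pdf (blk (c # cs)) s)"
  proof (cases "0 \<le> s")
    case True
    have "(\<integral>\<^sup>+y. ennreal (ME_pdf c (s - y)) * ennreal (ME_pdf (blk cs) y) \<partial>lborel)
        = (\<integral>\<^sup>+y. ennreal (ME_fun a A b (s - y) * ME_fun a' D z y) * indicator {0..s} y \<partial>lborel)"
      using c B by (intro nn_integral_cong)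
        (auto simp: c_eq B_eq ME_pdf_def ME_nonneg_def ennreal_mult split: split_indicator)
    then show ?thesis using conv True by (simp add: eq ME_pdf_def)
  next
    case False
    \<comment> \<open>For s < 0 one of \<open>s - y\<close> and \<open>y\<close> is negative, so a
      factor vanishes.\<close>
    then have "(\<integral>\<^sup>+y. ennreal (ME_pdf c (s - y)) * ennreal (ME_pdf (blk cs) y) \<partial>lborel) = (\<integral>\<^sup>+(y::real). 0 \<partial>lborel)"
      by (intro nn_integral_cong) (auto simp: c_eq B_eq ME_pdf_def)
    then show ?thesis using False by (simp add: eq ME_pdf_def)
  qed
qed

lemma ME_nonneg_blk: "cs \<noteq> [] \<Longrightarrow> (\<And>c. c \<in> set cs \<Longrightarrow> ME_nonneg c) \<Longrightarrow> ME_nonneg (blk cs)"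
proof (induction cs)
  case (Cons c cs)
  show ?case
  proof (cases "cs = []")
    case False
    then have "ME_nonneg (blk cs)" using Cons by simp
    then show ?thesis using blk_Cons_convolution(1)[of c cs] Cons.prems(2)[of c] False by simp
  qed (use Cons.prems in simp)
qed simp

text \<open>Downward induction on the first index \<open>a\<close>, from the last coordinate alone,
  follows the recursion of \<open>blk\<close>. The index interval avoids renumbering the coordinates
  of the product space.\<close>

lemma nn_integral_PiM_sum_ME_pdf:
  assumes ok: "\<And>c. c \<in> set cs \<Longrightarrow> ME_nonneg c" and a: "a < length cs"
    and g: "g \<in> borel_measurable borel"
  shows "(\<integral>\<^sup>+x. g (\<Sum>k\<in>{a..<length cs}. x k) * (\<Prod>k\<in>{a..<length cs}. ennreal (ME_pdf (cs ! k) (x k)))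
            \<partial>PiM {a..<length cs} (\<lambda>_. lborel))
       = (\<integral>\<^sup>+s. g s * ennreal (ME_pdf (blk (drop a cs)) s) \<partial>lborel)"
proof -
  define M where "M = length cs"
  define h where "h k x = ennreal (ME_pdf (cs ! k) x)" for k x
  have h_meas: "h k \<in> borel_measurable borel" if "k < M" for k
    unfolding h_def using borel_measurable_ME_pdf[OF ok[of "cs ! k"]] that by (simp add: M_def)
  interpret product_sigma_finite "\<lambda>_::nat. lborel :: real measure"
    by standard
  have "a \<le> M - 1" using a by (simp add: M_def)
  \<comment> \<open>The test function is quantified inside the induction: the step applies the
    hypothesis to \<open>\<Psi>\<close>, the integral of g over the new coordinate.\<close>
  then have "\<forall>g\<in>borel_measurable borel.
      (\<integral>\<^sup>+x. g (\<Sum>k\<in>{a..<M}. x k) * (\<Prod>k\<in>{a..<M}. h k (x k)) \<partial>PiM {a..<M} (\<lambda>_. lborel))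
       = (\<integral>\<^sup>+s. g s * ennreal (ME_pdf (blk (drop a cs)) s) \<partial>lborel)"
  proof (induction rule: inc_induct)
    case base
    have "{M - 1..<M} = {M - 1}" using a by (auto simp: M_def)
    moreover have "drop (M - 1) cs = [cs ! (M - 1)]"
      using Cons_nth_drop_Suc[of "M - 1" cs] a by (simp add: M_def)
    ultimately show ?case
    proof (intro ballI, goal_cases)
      case (1 g)
      have [measurable]: "g \<in> borel_measurable borel" by fact
      have [measurable]: "h (M - 1) \<in> borel_measurable borel" using h_meas a by (simp add: M_def)
      have "(\<lambda>x. g x * h (M - 1) x) \<in> borel_measurable lborel" by measurable
      from product_nn_integral_singleton[OF this, of "M - 1"] show ?case
        using 1 by (simp add: h_def)
    qed
  next
    case (step a)
    then have a: "Suc a < M" by simp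
    let ?I = "{Suc a..<M}"
    let ?B = "\<lambda>x. ennreal (ME_pdf (blk (drop (Suc a) cs)) x)"
    have I: "{a..<M} = insert a ?I" using a by auto
    have okB: "ME_nonneg (blk (drop (Suc a) cs))"
      using a ok by (intro ME_nonneg_blk) (auto simp: M_def dest: in_set_dropD)
    have okc: "ME_nonneg (cs ! a)" using a by (intro ok) (simp add: M_def)
    have dr: "drop a cs = cs ! a # drop (Suc a) cs" using a by (simp add: M_def Cons_nth_drop_Suc)
    show ?case
    proof
      fix g :: "real \<Rightarrow> ennreal" assume g[measurable]: "g \<in> borel_measurable borel"
      have [measurable]: "h k \<in> borel_measurable borel" if "k \<in> {a..<M}" for k
        using h_meas that by simp
      have ha[measurable]: "h a \<in> borel_measurable borel" using h_meas a by simp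
      have B[measurable]: "(\<lambda>x. ?B x) \<in> borel_measurable borel"
        using borel_measurable_ME_pdf[OF okB] by measurable
      have f: "(\<lambda>x. g (\<Sum>k\<in>insert a ?I. x k) * (\<Prod>k\<in>insert a ?I. h k (x k)))
          \<in> borel_measurable (PiM (insert a ?I) (\<lambda>_. lborel))"
        unfolding I[symmetric] by measurable
      define \<Psi> where "\<Psi> y = (\<integral>\<^sup>+x. g (x + y) * h a x \<partial>lborel)" for y
      have \<Psi>: "\<Psi> \<in> borel_measurable borel"
        unfolding \<Psi>_def by measurable
      have "(\<integral>\<^sup>+x. g (\<Sum>k\<in>{a..<M}. x k) * (\<Prod>k\<in>{a..<M}. h k (x k)) \<partial>PiM {a..<M} (\<lambda>_. lborel))
          = (\<integral>\<^sup>+x. (\<integral>\<^sup>+y. g (\<Sum>k\<in>insert a ?I. (x(a := y)) k) * (\<Prod>k\<in>insert a ?I. h k ((x(a := y)) k)) \<partial>lborel)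
              \<partial>PiM ?I (\<lambda>_. lborel))"
        unfolding I by (rule product_nn_integral_insert[OF _ _ f]) auto
      also have "\<dots> = (\<integral>\<^sup>+x. \<Psi> (\<Sum>k\<in>?I. x k) * (\<Prod>k\<in>?I. h k (x k)) \<partial>PiM ?I (\<lambda>_. lborel))"
      proof (intro nn_integral_cong)
        fix x :: "nat \<Rightarrow> real"
        have "(\<Sum>k\<in>?I. (x(a := y)) k) = (\<Sum>k\<in>?I. x k)" "(\<Prod>k\<in>?I. h k ((x(a := y)) k)) = (\<Prod>k\<in>?I. h k (x k))" for y
          by (auto intro!: sum.cong prod.cong)
        then show "(\<integral>\<^sup>+y. g (\<Sum>k\<in>insert a ?I. (x(a := y)) k) * (\<Prod>k\<in>insert a ?I. h k ((x(a := y)) k)) \<partial>lborel)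
            = \<Psi> (\<Sum>k\<in>?I. x k) * (\<Prod>k\<in>?I. h k (x k))"
          unfolding \<Psi>_def by (simp add: nn_integral_multc[symmetric] mult.assoc)
      qed
      also have "\<dots> = (\<integral>\<^sup>+y. \<Psi> y * ?B y \<partial>lborel)"
        using step.IH \<Psi> by blast
      \<comment> \<open>The substitution s = x + y, followed by Tonelli, exposes the convolution of
        the new density with the block density of the rest.\<close>
      also have "\<dots> = (\<integral>\<^sup>+y. (\<integral>\<^sup>+s. g s * h a (s - y) * ?B y \<partial>lborel) \<partial>lborel)"
      proof (intro nn_integral_cong)
        fix y :: real
        have "\<Psi> y = (\<integral>\<^sup>+s. g s * h a (s - y) \<partial>lborel)"
          using nn_integral_real_affine[of "\<lambda>s. g s * h a (s - y)" 1 y] by (simp add: \<Psi>_def add.commute)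
        then show "\<Psi> y * ?B y = (\<integral>\<^sup>+s. g s * h a (s - y) * ?B y \<partial>lborel)"
          by (simp add: nn_integral_multc)
      qed
      also have "\<dots> = (\<integral>\<^sup>+s. (\<integral>\<^sup>+y. g s * h a (s - y) * ?B y \<partial>lborel) \<partial>lborel)"
        by (rule lborel_pair.Fubini') measurable
      also have "\<dots> = (\<integral>\<^sup>+s. g s * (\<integral>\<^sup>+y. h a (s - y) * ?B y \<partial>lborel) \<partial>lborel)"
        by (simp add: nn_integral_cmult mult.assoc)
      also have "\<dots> = (\<integral>\<^sup>+s. g s * ennreal (ME_pdf (blk (drop a cs)) s) \<partial>lborel)"
        unfolding dr h_def using a by (subst blk_Cons_convolution(2)[OF okc okB]) (auto simp: M_def)
      finally show "(\<integral>\<^sup>+x. g (\<Sum>k\<in>{a..<M}. x k) * (\<Prod>k\<in>{a..<M}. h k (x k)) \<partial>PiM {a..<M} (\<lambda>_. lborel))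
          = (\<integral>\<^sup>+s. g s * ennreal (ME_pdf (blk (drop a cs)) s) \<partial>lborel)" .
    qed
  qed
  then show ?thesis using g unfolding M_def h_def by blast
qed


section \<open>The stop-loss moments\<close>

text \<open>Finiteness of each \<open>J is\<close> gives Bochner integrability, which permits the
  signed weights. A general \<open>g\<close> serves both the stop-loss moment and P(S > d).\<close>

lemma expectation_sum_MMEam:
  fixes Pr :: "'a measure" and X :: "nat \<Rightarrow> 'a \<Rightarrow> real" and g :: "real \<Rightarrow> real"
  assumes ok: "\<And>j. j \<in> {1..L} \<Longrightarrow> ME_nonneg (\<alpha> j, T j, t j)" and M: "M \<ge> 1"
    and fnonneg: "\<And>x. (\<forall>k<M. 0 \<le> x k) \<Longrightarrow> 0 \<le> MMEam_fun L M p \<alpha> T t x"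
    and dist: "distributed Pr (PiM {..<M} (\<lambda>_. lborel)) (\<lambda>\<omega>. \<lambda>k\<in>{..<M}. X k \<omega>)
                 (\<lambda>x. ennreal (MMEam_fun L M p \<alpha> T t x))"
    and g[measurable]: "g \<in> borel_measurable borel" and g_nonneg: "\<And>x. 0 \<le> g x"
    and J: "\<And>is. is \<in> idx_set L M \<Longrightarrow>
      (\<integral>\<^sup>+s. ennreal (g s) * ennreal (ME_pdf (alpha_I \<alpha> T t is, T_I \<alpha> T t is, t_I \<alpha> T t is) s) \<partial>lborel)
        = ennreal (J is)"
    and J_nonneg: "\<And>is. is \<in> idx_set L M \<Longrightarrow> 0 \<le> J is"
  shows "integral\<^sup>L Pr (\<lambda>\<omega>. g (\<Sum>k<M. X k \<omega>)) = (\<Sum>is\<in>idx_set L M. p is * J is)"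
proof -
  let ?N = "PiM {..<M} (\<lambda>_. lborel :: real measure)"
  define c where "c j = (\<alpha> j, T j, t j)" for j
  define H where "H is x = (\<Prod>k<M. ME_pdf (c (is ! k)) (x k))" for "is" and x :: "nat \<Rightarrow> real"
  \<comment> \<open>Off the orthant some factor of every product is 0, so the zero extensions absorb
    the case distinction.\<close>
  have f_eq: "MMEam_fun L M p \<alpha> T t x = (\<Sum>is\<in>idx_set L M. p is * H is x)" for x
  proof (cases "\<forall>k<M. 0 \<le> x k")
    case True
    then show ?thesis by (simp add: MMEam_fun_def H_def c_def ME_pdf_def)
  next
    case False
    then obtain k where "k < M" "x k < 0" by (auto simp: not_le)
    then have "H is x = 0" for "is"
      by (auto simp: H_def c_def ME_pdf_def intro!: bexI[of _ k])
    then show ?thesis using False unfolding MMEam_fun_def by auto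
  qed
  have f0: "0 \<le> MMEam_fun L M p \<alpha> T t x" for x
    using fnonneg[of x] by (cases "\<forall>k<M. 0 \<le> x k") (auto simp: MMEam_fun_def)
  have gsum: "(\<lambda>x. g (\<Sum>k<M. x k)) \<in> borel_measurable ?N" by measurable
  have bint: "has_bochner_integral ?N (\<lambda>x. g (\<Sum>k<M. x k) * H is x) (J is)" if "is": "is \<in> idx_set L M" for "is"
  proof -
    from "is" have len: "length is = M" and set: "set is \<subseteq> {1..L}" by (auto simp: idx_set_def)
    have okk: "ME_nonneg (c (is ! k))" if "k < M" for k
      using ok set len that unfolding c_def by (meson nth_mem subsetD)
    have ok_map: "ME_nonneg d" if "d \<in> set (map c is)" for d
      using that ok set by (auto simp: c_def)
    have [measurable]: "ME_pdf (c (is ! k)) \<in> borel_measurable borel" if "k \<in> {..<M}" for k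
      using okk that by (intro borel_measurable_ME_pdf) auto
    have H0: "0 \<le> H is x" for x
      unfolding H_def using okk by (intro prod_nonneg) (auto intro: ME_pdf_nonneg)
    show ?thesis
    proof (rule has_bochner_integral_nn_integral)
      show "(\<lambda>x. g (\<Sum>k<M. x k) * H is x) \<in> borel_measurable ?N"
        unfolding H_def by measurable
      show "AE x in ?N. 0 \<le> g (\<Sum>k<M. x k) * H is x" using g_nonneg H0 by simp
      show "0 \<le> J is" using J_nonneg "is" .
      have "(\<integral>\<^sup>+x. ennreal (g (\<Sum>k<M. x k) * H is x) \<partial>?N)
          = (\<integral>\<^sup>+x. ennreal (g (\<Sum>k\<in>{0..<length (map c is)}. x k)) *
              (\<Prod>k\<in>{0..<length (map c is)}. ennreal (ME_pdf (map c is ! k) (x k)))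
              \<partial>PiM {0..<length (map c is)} (\<lambda>_. lborel))"
        unfolding length_map len atLeast0LessThan
      proof (intro nn_integral_cong)
        fix x :: "nat \<Rightarrow> real"
        have "(\<Prod>k<M. ennreal (ME_pdf (map c is ! k) (x k))) = ennreal (H is x)"
          unfolding H_def using okk len by (subst prod_ennreal[symmetric]) (auto intro: ME_pdf_nonneg)
        then show "ennreal (g (\<Sum>k<M. x k) * H is x)
            = ennreal (g (\<Sum>k<M. x k)) * (\<Prod>k<M. ennreal (ME_pdf (map c is ! k) (x k)))"
          using g_nonneg H0 by (simp add: ennreal_mult)
      qed
      also have "\<dots> = (\<integral>\<^sup>+s. ennreal (g s) * ennreal (ME_pdf (blk (drop 0 (map c is))) s) \<partial>lborel)"
        by (rule nn_integral_PiM_sum_ME_pdf[OF ok_map, where g = "\<lambda>s. ennreal (g s)"]) (use len M in auto)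
      also have "blk (drop 0 (map c is)) = (alpha_I \<alpha> T t is, T_I \<alpha> T t is, t_I \<alpha> T t is)"
        by (simp add: alpha_I_def T_I_def t_I_def c_def[abs_def])
      finally show "(\<integral>\<^sup>+x. ennreal (g (\<Sum>k<M. x k) * H is x) \<partial>?N) = ennreal (J is)"
        using J[OF "is"] by simp
    qed
  qed
  have "integral\<^sup>L Pr (\<lambda>\<omega>. g (\<Sum>k<M. X k \<omega>))
      = integral\<^sup>L Pr (\<lambda>\<omega>. g (\<Sum>k<M. (\<lambda>k\<in>{..<M}. X k \<omega>) k))"
    by simp
  also have "\<dots> = (\<integral>x. MMEam_fun L M p \<alpha> T t x * g (\<Sum>k<M. x k) \<partial>?N)"
    by (rule distributed_integral[OF dist gsum, symmetric]) (rule f0)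
  also have "\<dots> = (\<integral>x. (\<Sum>is\<in>idx_set L M. p is * (g (\<Sum>k<M. x k) * H is x)) \<partial>?N)"
    unfolding f_eq by (simp add: sum_distrib_left sum_distrib_right mult_ac)
  also have "\<dots> = (\<Sum>is\<in>idx_set L M. p is * J is)"
    by (intro has_bochner_integral_integral_eq has_bochner_integral_sum has_bochner_integral_mult_right bint)
  finally show ?thesis .
qed

text \<open>The survival factor in \<open>pRL\<close> cancels the scaling in \<open>alphaRL\<close>,
  so every summand is the contribution of its index to the moment divided by P(S > d); the second
  factor of the product restores that denominator.\<close>

theorem theorem11:
  fixes Pr :: "'a measure" and X :: "nat \<Rightarrow> 'a \<Rightarrow> real"
    and L M r :: nat and d :: real
    and \<alpha> :: "nat \<Rightarrow> real vec" and T :: "nat \<Rightarrow> real mat" and t :: "nat \<Rightarrow> real vec"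
    and p :: "nat list \<Rightarrow> real"
  assumes "prob_space Pr"
    and "L \<ge> 1" and "M \<ge> 1"
    and ME: "\<And>j. j \<in> {1..L} \<Longrightarrow> ME_density (\<alpha> j) (T j) (t j)"
    and psum: "(\<Sum>is\<in>idx_set L M. p is) = 1"
    and fnonneg: "\<And>x. (\<forall>k<M. 0 \<le> x k) \<Longrightarrow> 0 \<le> MMEam_fun L M p \<alpha> T t x"
    and dist: "distributed Pr (PiM {..<M} (\<lambda>_. lborel)) (\<lambda>\<omega>. \<lambda>k\<in>{..<M}. X k \<omega>)
                 (\<lambda>x. ennreal (MMEam_fun L M p \<alpha> T t x))"
    and "r \<ge> 1" and "d \<ge> 0"
    and pos: "measure Pr {\<omega> \<in> space Pr. (\<Sum>k<M. X k \<omega>) > d} > 0"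
  shows "prob_space.expectation Pr (\<lambda>\<omega>. (max ((\<Sum>k<M. X k \<omega>) - d) 0) ^ r) =
    (\<Sum>is\<in>idx_set L M. pRL L M p \<alpha> T t d is * fact r *
        (alphaRL \<alpha> T t d is \<bullet>
           ((minv (- T_I \<alpha> T t is)) ^\<^sub>m (r + 1) *\<^sub>v t_I \<alpha> T t is))) *
    (\<Sum>is\<in>idx_set L M. p is * surv_I \<alpha> T t is d)"
proof -
  let ?I = "idx_set L M"
  let ?S = "\<lambda>\<omega>. \<Sum>k<M. X k \<omega>"
  define F where "F is = ME_fun (alpha_I \<alpha> T t is) (T_I \<alpha> T t is) (t_I \<alpha> T t is)" for "is"
  define f where "f is = ME_pdf (alpha_I \<alpha> T t is, T_I \<alpha> T t is, t_I \<alpha> T t is)" for "is"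
  define w where "w is = transpose_mat (mexp (d \<cdot>\<^sub>m T_I \<alpha> T t is)) *\<^sub>v alpha_I \<alpha> T t is" for "is"
  \<comment> \<open>The k-th tail moment about d of the block density: k = 0 is the survival value,
    k = r the contribution to the stop-loss moment.\<close>
  define J where "J k is = fact k * (w is \<bullet> (minv (- T_I \<alpha> T t is) ^\<^sub>m (k + 1) *\<^sub>v t_I \<alpha> T t is))"
    for k and "is" :: "nat list"
  have ok: "ME_nonneg (\<alpha> j, T j, t j)" if "j \<in> {1..L}" for j
    using ME[OF that] by (simp add: ME_nonneg_def ME_density_def)
  have okI: "ME_nonneg (alpha_I \<alpha> T t is, T_I \<alpha> T t is, t_I \<alpha> T t is)" if "is \<in> ?I" for "is"
  proof -
    have "ME_nonneg (blk (map (\<lambda>j. (\<alpha> j, T j, t j)) is))"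
      using that \<open>M \<ge> 1\<close> ok by (intro ME_nonneg_blk) (auto simp: idx_set_def)
    then show ?thesis by (simp add: alpha_I_def T_I_def t_I_def)
  qed
  have trip: "ME_triple (alpha_I \<alpha> T t is) (T_I \<alpha> T t is) (t_I \<alpha> T t is)"
    and F0: "\<And>x. 0 \<le> x \<Longrightarrow> 0 \<le> F is x" if "is \<in> ?I" for "is"
    using okI[OF that] by (auto simp: ME_nonneg_def F_def)
  have tail: "(\<integral>\<^sup>+x. ennreal ((x - d) ^ k * F is x) * indicator {d..} x \<partial>lborel) = ennreal (J k is)"
    and J0: "0 \<le> J k is" if "is \<in> ?I" for k "is"
    using nn_integral_ME_fun_tail[OF trip[OF that] F0[OF that, unfolded F_def] \<open>d \<ge> 0\<close>, of k]
    unfolding J_def w_def F_def by auto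
  have surv: "surv_I \<alpha> T t is d = J 0 is" if "is": "is \<in> ?I" for "is"
  proof -
    obtain n where a: "alpha_I \<alpha> T t is \<in> carrier_vec n" and A: "T_I \<alpha> T t is \<in> carrier_mat n n"
      and b: "t_I \<alpha> T t is \<in> carrier_vec n" and st: "stable (T_I \<alpha> T t is)"
      using trip[OF "is"] by (rule ME_tripleD)
    have N: "minv (- T_I \<alpha> T t is) \<in> carrier_mat n n" by (rule stable_minv(1)[OF A st])
    have E: "mexp (d \<cdot>\<^sub>m T_I \<alpha> T t is) \<in> carrier_mat n n" using A by auto
    have l: "l_I \<alpha> T t is \<in> carrier_vec n" using N b by (auto simp: l_I_def)
    have "minv (- T_I \<alpha> T t is) ^\<^sub>m (0 + 1) *\<^sub>v t_I \<alpha> T t is = l_I \<alpha> T t is"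
      using N by (simp add: l_I_def)
    then show ?thesis
      using transpose_vec_mult_scalar[OF E l a] by (simp add: surv_I_def J_def w_def)
  qed
  \<comment> \<open>A nonnegative density with zero tail integral vanishes almost everywhere beyond
    d, and all its tail moments vanish with it.\<close>
  have J_surv_0: "J k is = 0" if "is": "is \<in> ?I" and "J 0 is = 0" for k "is"
  proof -
    have [measurable]: "F is \<in> borel_measurable borel"
      unfolding F_def by (rule borel_measurable_ME_fun[OF trip[OF "is"]])
    have "(\<integral>\<^sup>+x. ennreal (F is x) * indicator {d..} x \<partial>lborel) = 0"
      using tail[OF "is", of 0] that by simp
    then have "AE x in lborel. ennreal (F is x) * indicator {d..} x = 0"
      by (subst (asm) nn_integral_0_iff_AE) auto
    then have "AE x in lborel. ennreal ((x - d) ^ k * F is x) * indicator {d..} x = 0"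
    proof eventually_elim
      case (elim x)
      then show ?case using \<open>d \<ge> 0\<close> F0[OF "is", of x]
        by (cases "d \<le> x") (auto simp: ennreal_eq_0_iff)
    qed
    then have "ennreal (J k is) = 0"
      unfolding tail[OF "is", of k, symmetric] by (subst nn_integral_0_iff_AE) auto
    then show ?thesis using J0[OF "is", of k] by (simp add: ennreal_eq_0_iff)
  qed
  have moment: "integral\<^sup>L Pr (\<lambda>\<omega>. (max (?S \<omega> - d) 0) ^ r) = (\<Sum>is\<in>?I. p is * J r is)"
  proof (rule expectation_sum_MMEam[OF ok \<open>M \<ge> 1\<close> fnonneg dist])
    fix "is" assume "is": "is \<in> ?I"
    have "(\<integral>\<^sup>+s. ennreal (max (s - d) 0 ^ r) * ennreal (f is s) \<partial>lborel)
        = (\<integral>\<^sup>+s. ennreal ((s - d) ^ r * F is s) * indicator {d..} s \<partial>lborel)"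
      \<comment> \<open>For s < d the integrand contains \<open>0 ^ r\<close>, which is 0 because r
        is positive; \<open>0 ^ 0\<close> would be 1.\<close>
      using \<open>r \<ge> 1\<close> \<open>d \<ge> 0\<close> F0[OF "is"] by (intro nn_integral_cong)
        (auto simp: f_def F_def ME_pdf_def ennreal_mult max_def split: split_indicator)
    then show "(\<integral>\<^sup>+s. ennreal (max (s - d) 0 ^ r) *
        ennreal (ME_pdf (alpha_I \<alpha> T t is, T_I \<alpha> T t is, t_I \<alpha> T t is) s) \<partial>lborel) = ennreal (J r is)"
      using tail[OF "is", of r] by (simp add: f_def)
  qed (use J0 in auto)
  have "integral\<^sup>L Pr (\<lambda>\<omega>. indicator {d<..} (?S \<omega>)) = (\<Sum>is\<in>?I. p is * J 0 is)"
  proof (rule expectation_sum_MMEam[OF ok \<open>M \<ge> 1\<close> fnonneg dist])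
    fix "is" assume "is": "is \<in> ?I"
    have "(\<integral>\<^sup>+s. ennreal (indicator {d<..} s) * ennreal (f is s) \<partial>lborel)
        = (\<integral>\<^sup>+s. ennreal ((s - d) ^ 0 * F is s) * indicator {d..} s \<partial>lborel)"
    \<comment> \<open>The event is S > d, the tail formula integrates over the closed half-line;
      they differ in the null set {d}.\<close>
    proof (rule nn_integral_cong_AE)
      show "AE s in lborel. ennreal (indicator {d<..} s) * ennreal (f is s)
          = ennreal ((s - d) ^ 0 * F is s) * indicator {d..} s"
        using AE_lborel_singleton[of d]
      proof eventually_elim
        case (elim s)
        then show ?case using \<open>d \<ge> 0\<close>
          by (auto simp: f_def F_def ME_pdf_def split: split_indicator)
      qed
    qed
    then show "(\<integral>\<^sup>+s. ennreal (indicator {d<..} s) *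
        ennreal (ME_pdf (alpha_I \<alpha> T t is, T_I \<alpha> T t is, t_I \<alpha> T t is) s) \<partial>lborel) = ennreal (J 0 is)"
      using tail[OF "is", of 0] by (simp add: f_def)
  qed (use J0 in auto)
  also have "(\<lambda>\<omega>. indicator {d<..} (?S \<omega>)) = (indicator (?S -` {d<..}) :: 'a \<Rightarrow> real)"
    by (auto simp: indicator_def)
  also have "integral\<^sup>L Pr (indicator (?S -` {d<..})) = measure Pr {\<omega> \<in> space Pr. ?S \<omega> > d}"
    by (simp add: vimage_def Int_def conj_commute)
  finally have D: "(\<Sum>hs\<in>?I. p hs * surv_I \<alpha> T t hs d) > 0"
    using pos surv by simp
  have term_eq: "pRL L M p \<alpha> T t d is * fact r *
      (alphaRL \<alpha> T t d is \<bullet> ((minv (- T_I \<alpha> T t is)) ^\<^sub>m (r + 1) *\<^sub>v t_I \<alpha> T t is))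
      = p is * J r is / (\<Sum>hs\<in>?I. p hs * surv_I \<alpha> T t hs d)" if "is": "is \<in> ?I" for "is"
  proof -
    have "alphaRL \<alpha> T t d is \<bullet> ((minv (- T_I \<alpha> T t is)) ^\<^sub>m (r + 1) *\<^sub>v t_I \<alpha> T t is)
        = 1 / surv_I \<alpha> T t is d * (w is \<bullet> ((minv (- T_I \<alpha> T t is)) ^\<^sub>m (r + 1) *\<^sub>v t_I \<alpha> T t is))"
    proof -
      obtain n where a: "alpha_I \<alpha> T t is \<in> carrier_vec n" and A: "T_I \<alpha> T t is \<in> carrier_mat n n"
        and b: "t_I \<alpha> T t is \<in> carrier_vec n" and st: "stable (T_I \<alpha> T t is)"
        using trip[OF "is"] by (rule ME_tripleD)
      have "w is \<in> carrier_vec n"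
        unfolding w_def using A a by (intro mult_mat_vec_carrier[of _ n n]) auto
      then show ?thesis
        unfolding alphaRL_def w_def[symmetric]
        by (rule smult_scalar_prod_distrib)
           (rule pow_mat_mult_vec_carrier[OF stable_minv(1)[OF A st] b])
    qed
    \<comment> \<open>If the survival value is 0, the left side is 0 by the convention for division
      by zero, and \<open>J_surv_0\<close> makes the right side 0 as well.\<close>
    then show ?thesis
      using J_surv_0[OF "is", of r] surv[OF "is"]
      by (cases "surv_I \<alpha> T t is d = 0") (simp_all add: pRL_def J_def)
  qed
  show ?thesis
    using D unfolding moment by (simp add: term_eq sum_divide_distrib[symmetric] del: One_nat_def add_Suc_right)
qed

end
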